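(* Let $G$ be a planar graph and let $R\subseteq E(G)$ be a neighbouring set of edges. Then $\mu^{\ast}(G[R])=\tfrac{9}{2}$ if and only if $G[R]$ contains a subgraph isomorphic to one of the following graphs: $$3K_3,\quad K_3+3K_2,\quad C_7+K_2.$$
   Context: Graphs are finite, simple and without loops. A set $R\subseteq E(G)$ is a neighbouring set (in $G$) if for every two edges $e,f\in R$ there exist an endvertex $u$ of $e$ and an endvertex $v$ of $f$ with $d_G(u,v)\leq 1$ (i.e. $u=v$ or $uv\in E(G)$). $G[R]$ denotes the subgraph of $G$ induced by the edges of $R$: its vertices are exactly the endvertices of edges in $R$, and its edges are exactly the edges of $R$. A fractional matching of a graph $H$ is a map $g:E(H)\to\mathbb{R}_{\geq 0}$ such that for every vertex $v$, the sum of $g(e)$ over the edges $e$ incident to $v$ is at most $1$; its value is $\sum_{e\in E(H)}g(e)$, and $\mu^{\ast}(H)$ is the supremum of the values of all fractional matchings of $H$. $K_k$ is the complete graph on $k$ vertices, $C_k$ the cycle on $k$ vertices, $A+B$ denotes the disjoint union of graphs $A$ and $B$, and $nA$ the disjoint union of $n$ copies of $A$. Subgraphs are not required to be induced. *)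

theory Defs
  imports "HOL-Analysis.Analysis"
begin

section \<open>Graphs\<close>

text \<open>A graph is a pair of a vertex set and an edge set; an edge is the two-element set of
  its endvertices.\<close>

type_synonym 'a graph = "'a set \<times> 'a set set"

abbreviation verts :: "'a graph \<Rightarrow> 'a set" where
  "verts G \<equiv> fst G"

abbreviation edges :: "'a graph \<Rightarrow> 'a set set" where
  "edges G \<equiv> snd G"

definition simple_graph :: "'a graph \<Rightarrow> bool" where
  "simple_graph G \<longleftrightarrow> finite (verts G) \<and> (\<forall>e\<in>edges G. e \<subseteq> verts G \<and> card e = 2)"

definition subgraph :: "'a graph \<Rightarrow> 'a graph \<Rightarrow> bool" where
  "subgraph S H \<longleftrightarrow> simple_graph S \<and> verts S \<subseteq> verts H \<and> edges S \<subseteq> edges H"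

definition isomorphic :: "'a graph \<Rightarrow> 'b graph \<Rightarrow> bool" where
  "isomorphic A B \<longleftrightarrow>
     (\<exists>\<phi>. bij_betw \<phi> (verts A) (verts B) \<and> edges B = (\<lambda>e. \<phi> ` e) ` edges A)"

definition contains_subgraph :: "'a graph \<Rightarrow> 'b graph \<Rightarrow> bool" where
  "contains_subgraph H A \<longleftrightarrow> (\<exists>S. subgraph S H \<and> isomorphic A S)"

definition edge_induced :: "'a set set \<Rightarrow> 'a graph" where
  "edge_induced R = (\<Union>R, R)"


section \<open>Planarity\<close>

text \<open>The plane is modelled by the type of complex numbers, as in the library's treatment of
  the Jordan curve theorem. Distinct vertices are drawn as distinct points \<open>p v\<close>, and an edge
  \<open>e\<close> as an arc \<open>\<gamma> e\<close> joining its endvertices; an arc meets the vertices only in its own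
  endpoints, and two arcs meet only in common endpoints.\<close>

definition plane_drawing ::
  "'a graph \<Rightarrow> ('a \<Rightarrow> complex) \<Rightarrow> ('a set \<Rightarrow> real \<Rightarrow> complex) \<Rightarrow> bool" where
  "plane_drawing G p \<gamma> \<longleftrightarrow>
     inj_on p (verts G) \<and>
     (\<forall>e\<in>edges G. arc (\<gamma> e) \<and> {pathstart (\<gamma> e), pathfinish (\<gamma> e)} = p ` e) \<and>
     (\<forall>e\<in>edges G. path_image (\<gamma> e) \<inter> p ` verts G = p ` e) \<and>
     (\<forall>e\<in>edges G. \<forall>f\<in>edges G. e \<noteq> f \<longrightarrow>
        path_image (\<gamma> e) \<inter> path_image (\<gamma> f) = p ` (e \<inter> f))"

definition planar :: "'a graph \<Rightarrow> bool" where
  "planar G \<longleftrightarrow> (\<exists>p \<gamma>. plane_drawing G p \<gamma>)"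


section \<open>Neighbouring sets and fractional matchings\<close>

text \<open>In the next definition, the disjunction says that \<open>u\<close> and \<open>v\<close> are at distance at
  most 1 in \<open>G\<close>.\<close>

definition neighbouring :: "'a graph \<Rightarrow> 'a set set \<Rightarrow> bool" where
  "neighbouring G R \<longleftrightarrow> R \<subseteq> edges G \<and>
     (\<forall>e\<in>R. \<forall>f\<in>R. \<exists>u\<in>e. \<exists>v\<in>f. u = v \<or> {u, v} \<in> edges G)"

definition fractional_matching :: "'a graph \<Rightarrow> ('a set \<Rightarrow> real) \<Rightarrow> bool" where
  "fractional_matching H g \<longleftrightarrow>
     (\<forall>e\<in>edges H. 0 \<le> g e) \<and>
     (\<forall>v\<in>verts H. (\<Sum>e\<in>{e\<in>edges H. v \<in> e}. g e) \<le> 1)"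

text \<open>The supremum is taken over a nonempty set (\<open>g = 0\<close> is allowed), which for a simple graph
  is bounded above.\<close>

definition frac_matching_number :: "'a graph \<Rightarrow> real" where
  "frac_matching_number H = (SUP g\<in>{g. fractional_matching H g}. \<Sum>e\<in>edges H. g e)"


section \<open>Special graphs\<close>

definition complete_graph :: "nat \<Rightarrow> nat graph" where
  "complete_graph k = ({..<k}, {{i, j} | i j. i < k \<and> j < k \<and> i \<noteq> j})"

text \<open>The following is a cycle only for \<open>k \<ge> 3\<close>.\<close>

definition cycle_graph :: "nat \<Rightarrow> nat graph" where
  "cycle_graph k = ({..<k}, {{i, Suc i mod k} | i. i < k})"

definition disjoint_union :: "'a graph \<Rightarrow> 'b graph \<Rightarrow> ('a + 'b) graph" where
  "disjoint_union A B =
     (verts A <+> verts B, (\<lambda>e. Inl ` e) ` edges A \<union> (\<lambda>e. Inr ` e) ` edges B)"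

definition copies :: "nat \<Rightarrow> 'a graph \<Rightarrow> (nat \<times> 'a) graph" where
  "copies n A = ({..<n} \<times> verts A, {Pair i ` e | i e. i < n \<and> e \<in> edges A})"

end

theory Submission
  imports Defs
begin

text \<open>By Koenig's theorem on the bipartite double cover, the fractional matching number is half the
  maximal size of a set of arcs with distinct tails and distinct heads, and such a set splits into
  disjoint edges and odd cycles. Five disjoint edges of a neighbouring set are the branch sets of a
  \<open>K\<^sub>5\<close> minor, so at most four disjoint edges occur; this leaves finitely many ways to reach the value
  9/2 or more. All of them except the three in the theorem force a \<open>K\<^sub>5\<close> minor, usually formed by a
  single vertex and four disjoint edges, or, for a single cycle of length nine, a \<open>K\<^sub>3\<^sub>3\<close> minor.

  That a plane drawing has no such minor follows from a parity argument in the style of van Kampen.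
  Join representatives of the branch sets by curves, so that curves belonging to disjoint edges
  \<open>ab\<close>, \<open>cd\<close> are disjoint. Then the logarithm of \<open>\<gamma>\<^sub>a\<^sub>b(s) - \<gamma>\<^sub>c\<^sub>d(t)\<close> is single valued on the square, so its
  changes along the four sides cancel. Comparing with a fixed choice of logarithms of the
  differences of the vertices gives an integer relation for each pair of disjoint edges, and these
  relations add up to a parity contradiction.\<close>

section \<open>Drawings of complete graphs and the logarithm\<close>

text \<open>Two numbers of a packing decide the case analysis: T, the number of disjoint edges
  obtained from it, and c, the number of its odd cycles. A cycle of length \<open>2 * k + 1\<close>
  yields k disjoint edges and carries one arc more than twice that number, so a packing accounts for
  \<open>2 * T + c\<close> arcs, and T is at most 4. Trading a cycle for edges keeps T, so excluding
  T = 4 with exactly two cycles excludes T = 4 with any larger number of them. Nine arcs then leave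
  T = 4 with one cycle, of length 3, 5, 7 or 9, or T = 3 with three cycles, which must be triangles.
  Lengths 5 and 9 have to be excluded on their own.

  The arcs of a drawing are merely continuous, and curves routed through a common branch set may run
  along each other, so crossings cannot be counted directly. Changes of logarithms need only that
  curves of disjoint edges are disjoint, and the integers that depend on the drawing disappear
  modulo 4.\<close>

definition log_change :: "(real \<Rightarrow> complex) \<Rightarrow> complex \<Rightarrow> complex" where
  "log_change \<gamma> z = (SOME w. \<exists>L. continuous_on {0..1} L \<and>
     (\<forall>s\<in>{0..1}. exp (L s) = \<gamma> s - z) \<and> w = L 1 - L 0)"

text \<open>Two logarithms of the same function differ by multiples of \<open>2 * pi * \<i>\<close>,
  a discrete set, so a continuous difference is constant on the interval. This makes
  \<open>log_change\<close> independent of the chosen logarithm; if z lies on the path, no logarithm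
  exists and the value is arbitrary.\<close>

lemma continuous_logs_differ_by_constant:
  fixes L M :: "real \<Rightarrow> complex"
  assumes "continuous_on {0..1} L" "continuous_on {0..1} M"
    and eq: "\<And>s. s \<in> {0..1} \<Longrightarrow> exp (L s) = exp (M s)"
  shows "L 1 - L 0 = M 1 - M 0"
proof -
  have "(\<lambda>s. L s - M s) constant_on {0..1}"
  proof (rule continuous_discrete_range_constant)
    show "connected {0..1::real}" by simp
    show "continuous_on {0..1} (\<lambda>s. L s - M s)"
      using assms by (intro continuous_intros)
    fix x :: real assume x: "x \<in> {0..1}"
    show "\<exists>e>0. \<forall>y. y \<in> {0..1} \<and> L y - M y \<noteq> L x - M x \<longrightarrow>
            e \<le> cmod (L y - M y - (L x - M x))"
    proof (intro exI [of _ "2*pi"] conjI allI impI)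
      fix y assume y: "y \<in> {0..1} \<and> L y - M y \<noteq> L x - M x"
      let ?d = "L y - M y - (L x - M x)"
      have "exp ?d = 1" using eq [of x] eq [of y] x y
        by (simp add: exp_diff)
      then obtain n :: int where "Re ?d = 0" and n: "Im ?d = of_int (2 * n) * pi"
        unfolding exp_eq_1 by blast
      then have "n \<noteq> 0" using y by (auto simp: complex_eq_iff)
      then have "1 \<le> \<bar>of_int n :: real\<bar>" by linarith
      then have "2 * pi \<le> \<bar>Im ?d\<bar>" unfolding n by (simp add: abs_mult)
      then show "2 * pi \<le> cmod ?d" using abs_Im_le_cmod [of ?d] by linarith
    qed simp
  qed
  then obtain c where "\<And>s. s \<in> {0..1} \<Longrightarrow> L s - M s = c"
    unfolding constant_on_def by blast
  from this [of 0] this [of 1] show ?thesis by (simp add: algebra_simps)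
qed

lemma log_change_eq:
  assumes "continuous_on {0..1} L" "\<And>s. s \<in> {0..1} \<Longrightarrow> exp (L s) = \<gamma> s - z"
  shows "log_change \<gamma> z = L 1 - L 0"
  unfolding log_change_def
proof (rule someI2)
  show "\<exists>M. continuous_on {0..1} M \<and>
     (\<forall>s\<in>{0..1}. exp (M s) = \<gamma> s - z) \<and> L 1 - L 0 = M 1 - M 0"
    using assms by blast
next
  fix w assume "\<exists>M. continuous_on {0..1} M \<and>
     (\<forall>s\<in>{0..1}. exp (M s) = \<gamma> s - z) \<and> w = M 1 - M 0"
  then obtain M where "continuous_on {0..1} M" "w = M 1 - M 0"
    "\<forall>s\<in>{0..1}. exp (M s) = \<gamma> s - z" by blast
  then show "w = L 1 - L 0"
    using continuous_logs_differ_by_constant [of M L] assms by simp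
qed

text \<open>Prescribed logarithms at the two ends fix the change up to a full number of turns. This
  integer is the only trace of the drawing that survives in \<open>turning_numbers\<close>.\<close>

lemma log_change_endpoints:
  assumes "path \<gamma>" "z \<notin> path_image \<gamma>"
    and u: "exp u = pathstart \<gamma> - z" and v: "exp v = pathfinish \<gamma> - z"
  obtains n :: int where "log_change \<gamma> z = v - u + 2 * pi * of_int n * \<i>"
proof -
  have "continuous_on {0..1} (\<lambda>s. \<gamma> s - z)"
    using assms(1) by (auto simp: path_def intro: continuous_intros)
  moreover have "\<And>s. s \<in> {0..1} \<Longrightarrow> \<gamma> s - z \<noteq> 0"
    using assms(2) by (auto simp: path_image_def)
  ultimately obtain L where L: "continuous_on {0..1} L"
      "\<And>s. s \<in> {0..1} \<Longrightarrow> \<gamma> s - z = exp (L s)"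
    using continuous_logarithm_on_contractible [OF _ convex_imp_contractible, of "{0..1}" "\<lambda>s. \<gamma> s - z"]
    by (metis convex_real_interval(5))
  have 1: "log_change \<gamma> z = L 1 - L 0"
    by (rule log_change_eq) (use L in auto)
  have "exp u = exp (L 0)" "exp v = exp (L 1)"
    using u v L(2) [of 0] L(2) [of 1] by (auto simp: pathstart_def pathfinish_def)
  then have "exp (L 1 - L 0 - (v - u)) = 1" by (simp add: exp_diff)
  then obtain n :: int where "Re (L 1 - L 0 - (v - u)) = 0"
     "Im (L 1 - L 0 - (v - u)) = of_int (2 * n) * pi"
    unfolding exp_eq_1 by blast
  then have "L 1 - L 0 = v - u + 2 * pi * of_int n * \<i>"
    by (simp add: complex_eq_iff algebra_simps)
  with 1 that show thesis by metis
qed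

lemma log_change_square:
  assumes "path \<gamma>" "path \<delta>" and disj: "path_image \<gamma> \<inter> path_image \<delta> = {}"
  shows "log_change \<gamma> (pathstart \<delta>) + log_change \<delta> (pathfinish \<gamma>) =
         log_change \<gamma> (pathfinish \<delta>) + log_change \<delta> (pathstart \<gamma>)"
proof -
  let ?Q = "{0..1::real} \<times> {0..1::real}"
  have "continuous_on ?Q (\<lambda>q. \<gamma> (fst q))"
    by (rule continuous_on_compose2 [OF assms(1) [unfolded path_def] continuous_on_fst])
      (auto intro: continuous_intros)
  moreover have "continuous_on ?Q (\<lambda>q. \<delta> (snd q))"
    by (rule continuous_on_compose2 [OF assms(2) [unfolded path_def] continuous_on_snd])
      (auto intro: continuous_intros)
  ultimately have "continuous_on ?Q (\<lambda>q. \<gamma> (fst q) - \<delta> (snd q))"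
    by (rule continuous_on_diff)
  moreover have "\<And>q. q \<in> ?Q \<Longrightarrow> \<gamma> (fst q) - \<delta> (snd q) \<noteq> 0"
    using disj by (force simp: path_image_def)
  moreover have "contractible ?Q"
    by (intro convex_imp_contractible convex_Times) auto
  ultimately obtain L where L: "continuous_on ?Q L"
      "\<And>q. q \<in> ?Q \<Longrightarrow> \<gamma> (fst q) - \<delta> (snd q) = exp (L q)"
    using continuous_logarithm_on_contractible by blast
  have c1: "continuous_on {0..1} (\<lambda>s. L (s, t))" if "t \<in> {0..1}" for t
    by (rule continuous_on_compose2 [OF L(1), of _ "\<lambda>s. (s, t)"])
      (use that in \<open>auto intro!: continuous_on_Pair\<close>)
  have "continuous_on {0..1} (\<lambda>t. L (s, t))" if "s \<in> {0..1}" for s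
    by (rule continuous_on_compose2 [OF L(1), of _ "\<lambda>t. (s, t)"])
      (use that in \<open>auto intro!: continuous_on_Pair\<close>)
  \<comment> \<open>Along the sides where \<delta> moves, \<open>log_change\<close> refers to
    \<delta> - \<gamma>, the negative of the function on the square. Adding \<open>\<i> * pi\<close>
    to L corrects the sign, and the constant cancels in the difference of end values.\<close>
  then have c2: "continuous_on {0..1} (\<lambda>t. L (s, t) + \<i> * pi)" if "s \<in> {0..1}" for s
    using that by (intro continuous_on_add continuous_on_const)
  have "log_change \<gamma> (pathstart \<delta>) = L (1, 0) - L (0, 0)"
    using L(2)[of "(_,0)"] by (intro log_change_eq c1) (auto simp: pathstart_def)
  moreover have "log_change \<gamma> (pathfinish \<delta>) = L (1, 1) - L (0, 1)"
    using L(2)[of "(_,1)"] by (intro log_change_eq c1) (auto simp: pathfinish_def)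
  moreover have "log_change \<delta> (pathfinish \<gamma>) = (L (1, 1) + \<i> * pi) - (L (1, 0) + \<i> * pi)"
    using L(2)[of "(1,_)"] by (intro log_change_eq c2) (simp_all add: pathfinish_def exp_add flip: L(2))
  moreover have "log_change \<delta> (pathstart \<gamma>) = (L (0, 1) + \<i> * pi) - (L (0, 0) + \<i> * pi)"
    using L(2)[of "(0,_)"] by (intro log_change_eq c2) (simp_all add: pathstart_def exp_add flip: L(2))
  ultimately show ?thesis by simp
qed

text \<open>The sign records by which odd multiple of \<open>\<i> * pi\<close> the two chosen
  logarithms, of \<open>p a - p b\<close> and of \<open>p b - p a\<close>, differ.\<close>

definition order_sign :: "nat \<Rightarrow> nat \<Rightarrow> int" where
  "order_sign a b = (if a < b then - 1 else 1)"

lemma cancel_pi_i: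
  assumes "of_real (2 * pi * of_int N) * \<i> = \<i> * pi * of_int S"
  shows "2 * N = S"
proof -
  have "Im (of_real (2 * pi * of_int N) * \<i>) = Im (\<i> * pi * of_int S)"
    using assms by (rule arg_cong)
  then have "2 * real_of_int N = real_of_int S" by simp
  then show ?thesis by linarith
qed

text \<open>For \<open>E a b\<close>, \<open>g a b\<close> is a curve from \<open>p a\<close> to \<open>p b\<close>; only curves without a common endpoint
  are required to be disjoint, so that such a map also arises from a minor of a plane graph.\<close>

definition edge_map ::
  "(nat \<Rightarrow> nat \<Rightarrow> bool) \<Rightarrow> (nat \<Rightarrow> complex) \<Rightarrow> (nat \<Rightarrow> nat \<Rightarrow> real \<Rightarrow> complex) \<Rightarrow> bool" where
  "edge_map E p g \<longleftrightarrow>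
     (\<forall>a b. E a b \<longrightarrow> path (g a b) \<and> pathstart (g a b) = p a \<and> pathfinish (g a b) = p b) \<and>
     (\<forall>a b c d. E a b \<longrightarrow> E c d \<longrightarrow> {a, b} \<inter> {c, d} = {} \<longrightarrow>
        path_image (g a b) \<inter> path_image (g c d) = {})"

text \<open>The right-hand side is 0 or \<open>\<plusminus>2\<close>: it is nonzero iff the chords \<open>ab\<close> and \<open>cd\<close> cross when the
  vertices are placed on a circle in their natural order.\<close>

definition turning_numbers :: "(nat \<Rightarrow> nat \<Rightarrow> bool) \<Rightarrow> (nat \<Rightarrow> nat \<Rightarrow> nat \<Rightarrow> int) \<Rightarrow> bool" where
  "turning_numbers E n \<longleftrightarrow> (\<forall>a b c d. E a b \<longrightarrow> E c d \<longrightarrow> {a, b} \<inter> {c, d} = {} \<longrightarrow>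
      2 * (n a b c + n c d b - n a b d - n c d a) =
      order_sign c b + order_sign b d + order_sign d a + order_sign a c)"

lemma ex_turning_numbers:
  assumes "edge_map E p g"
  shows "\<exists>n. turning_numbers E n"
proof -
  have path: "path (g a b) \<and> pathstart (g a b) = p a \<and> pathfinish (g a b) = p b"
    if "E a b" for a b
    using assms that unfolding edge_map_def by simp
  have disj: "path_image (g a b) \<inter> path_image (g c d) = {}"
    if "E a b" "E c d" "{a, b} \<inter> {c, d} = {}" for a b c d
    using assms that unfolding edge_map_def by simp
  \<comment> \<open>One principal logarithm is chosen per unordered pair, and the opposite
    difference gets it shifted by \<open>\<i> * pi\<close>. Thus swapping the arguments changes
    \<theta> by exactly \<open>\<i> * pi\<close> up to a sign that depends on the order of the
    labels alone, not on the drawing.\<close>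
  define \<theta> where "\<theta> a b = (if a < b then Ln (p a - p b) else Ln (p b - p a) + \<i> * pi)" for a b
  have exp_\<theta>: "exp (\<theta> a b) = p a - p b" if "p a \<noteq> p b" for a b
    using that by (auto simp: \<theta>_def exp_add)
  have \<theta>_swap: "\<theta> a b - \<theta> b a = \<i> * pi * of_int (order_sign a b)" if "a \<noteq> b" for a b
    using that by (auto simp: \<theta>_def order_sign_def)
  have ex: "\<exists>n. log_change (g a b) (p c) = \<theta> b c - \<theta> a c + 2 * pi * of_int n * \<i>"
    if "E a b" "p c \<notin> path_image (g a b)" for a b c
  proof -
    have "p a \<noteq> p c" "p b \<noteq> p c"
      using that path [OF that(1)] pathstart_in_path_image [of "g a b"]
        pathfinish_in_path_image [of "g a b"] by auto
    then show ?thesis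
      using log_change_endpoints [of "g a b" "p c" "\<theta> a c" "\<theta> b c"] path [OF that(1)] that(2)
      by (metis exp_\<theta>)
  qed
  define n where "n a b c =
    (SOME n. log_change (g a b) (p c) = \<theta> b c - \<theta> a c + 2 * pi * of_int n * \<i>)" for a b c
  have n: "log_change (g a b) (p c) = \<theta> b c - \<theta> a c + 2 * pi * of_int (n a b c) * \<i>"
    if "E a b" "p c \<notin> path_image (g a b)" for a b c
    unfolding n_def by (rule someI_ex) (rule ex [OF that])
  show ?thesis
    unfolding turning_numbers_def
  proof (intro exI [of _ n] allI impI)
    fix a b c d assume ab: "E a b" and cd: "E c d" and d: "{a, b} \<inter> {c, d} = {}"
    have ne: "c \<noteq> b" "b \<noteq> d" "d \<noteq> a" "a \<noteq> c" using d by auto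
    note pab = path [OF ab] and pcd = path [OF cd] and dj = disj [OF ab cd d]
    have "p a \<in> path_image (g a b)" "p b \<in> path_image (g a b)"
      "p c \<in> path_image (g c d)" "p d \<in> path_image (g c d)"
      using pab pcd by (metis pathstart_in_path_image pathfinish_in_path_image)+
    then have out: "p a \<notin> path_image (g c d)" "p b \<notin> path_image (g c d)"
      "p c \<notin> path_image (g a b)" "p d \<notin> path_image (g a b)"
      using dj by auto
    have "log_change (g a b) (p c) + log_change (g c d) (p b) =
          log_change (g a b) (p d) + log_change (g c d) (p a)"
      using log_change_square [of "g a b" "g c d"] pab pcd dj by simp
    then have "2 * pi * of_int (n a b c + n c d b - n a b d - n c d a) * \<i> =
       (\<theta> c b - \<theta> b c) + (\<theta> b d - \<theta> d b) + (\<theta> d a - \<theta> a d) + (\<theta> a c - \<theta> c a)"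
      unfolding n [OF ab out(3)] n [OF ab out(4)] n [OF cd out(1)] n [OF cd out(2)]
      by (simp add: algebra_simps)
    also have "\<dots> = \<i> * pi * of_int (order_sign c b + order_sign b d + order_sign d a + order_sign a c)"
      unfolding \<theta>_swap [OF ne(1)] \<theta>_swap [OF ne(2)] \<theta>_swap [OF ne(3)] \<theta>_swap [OF ne(4)]
      by (simp add: algebra_simps)
    finally show "2 * (n a b c + n c d b - n a b d - n c d a) =
      order_sign c b + order_sign b d + order_sign d a + order_sign a c"
      by (rule cancel_pi_i)
  qed
qed

text \<open>In the sum over all pairs of disjoint edges every \<open>n a b c\<close> occurs an even number of times,
  whereas the number of crossings in the circular drawing is odd. The same happens for \<open>K\<^sub>3\<^sub>3\<close>, whose
  vertex classes are the even and the odd numbers.\<close>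

lemma no_K5_map: "\<not> edge_map (\<lambda>a b. a < b \<and> b < 5) p g"
proof
  assume "edge_map (\<lambda>a b. a < b \<and> b < 5) p g"
  then obtain n where n: "turning_numbers (\<lambda>a b. a < b \<and> b < 5) n"
    using ex_turning_numbers by blast
  define F where "F a b c d = 2 * (n a b c + n c d b - n a b d - n c d a)" for a b c d
  define S where "S a b c d = order_sign c b + order_sign b d + order_sign d a + order_sign a c" for a b c d
  have FS: "F a b c d = S a b c d"
    \<comment> \<open>The list below holds the 15 unordered pairs of disjoint edges of K5. For a
      fixed edge \<open>ab\<close>, each other vertex \<open>c\<close> lies on two of the three
      edges disjoint from \<open>ab\<close>, so \<open>n a b c\<close> enters with coefficient 0 or
      \<plusminus>4. The five crossing pairs contribute -2 each, which gives -10.\<close>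
    if "a < b \<and> b < 5" "c < d \<and> d < 5" "a \<noteq> c \<and> a \<noteq> d \<and> b \<noteq> c \<and> b \<noteq> d" for a b c d
    using n that unfolding F_def S_def turning_numbers_def by simp
  let ?ps = "[(0,1,2,3), (0,1,2,4), (0,1,3,4), (0,2,1,3), (0,2,1,4), (0,2,3,4),
    (0,3,1,2), (0,3,1,4), (0,3,2,4), (0,4,1,2), (0,4,1,3), (0,4,2,3),
    (1,2,3,4), (1,3,2,4), (1,4,2,3)] :: (nat \<times> nat \<times> nat \<times> nat) list"
  have "4 * (n 0 1 2 - n 0 1 4 + n 0 2 1 - n 0 2 4 + n 0 3 1 - n 0 3 4 + n 0 4 1 - n 0 4 3 - n 1 2 0 + n 1 2 3 -
    n 1 3 0 + n 1 3 2 - n 1 4 0 + n 1 4 2 - n 2 3 0 + n 2 3 4 - n 2 4 0 + n 2 4 3 - n 3 4 0 + n 3 4 2) =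
    (\<Sum>(a, b, c, d)\<leftarrow>?ps. F a b c d)"
    by (simp only: list.map sum_list.Cons sum_list.Nil prod.case F_def) algebra
  also have "\<dots> = (\<Sum>(a, b, c, d)\<leftarrow>?ps. S a b c d)"
    by (simp add: FS)
  also have "\<dots> = -10" by (simp add: S_def order_sign_def)
  finally have "4 * (n 0 1 2 - n 0 1 4 + n 0 2 1 - n 0 2 4 + n 0 3 1 - n 0 3 4 + n 0 4 1 - n 0 4 3 - n 1 2 0 + n 1 2 3 -
    n 1 3 0 + n 1 3 2 - n 1 4 0 + n 1 4 2 - n 2 3 0 + n 2 3 4 - n 2 4 0 + n 2 4 3 - n 3 4 0 + n 3 4 2) = -10" .
  moreover have "4 * k \<noteq> (-10 :: int)" for k by presburger
  ultimately show False by blast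
qed

lemma no_K33_map: "\<not> edge_map (\<lambda>a b. a < b \<and> b < 6 \<and> odd (a + b)) p g"
proof
  assume "edge_map (\<lambda>a b. a < b \<and> b < 6 \<and> odd (a + b)) p g"
  then obtain n where n: "turning_numbers (\<lambda>a b. a < b \<and> b < 6 \<and> odd (a + b)) n"
    using ex_turning_numbers by blast
  define F where "F a b c d = 2 * (n a b c + n c d b - n a b d - n c d a)" for a b c d
  define S where "S a b c d = order_sign c b + order_sign b d + order_sign d a + order_sign a c" for a b c d
  have FS: "F a b c d = S a b c d"
    \<comment> \<open>Of the 18 pairs of disjoint edges only the three pairs among the long
      diagonals 03, 14, 25 cross, hence the total -6. The edges disjoint from a given edge form a
      four-cycle, so again each integer occurs twice.\<close>
    if "a < b \<and> b < 6 \<and> odd (a + b)" "c < d \<and> d < 6 \<and> odd (c + d)" "a \<noteq> c \<and> a \<noteq> d \<and> b \<noteq> c \<and> b \<noteq> d" for a b c d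
    using n that unfolding F_def S_def turning_numbers_def by simp
  let ?ps = "[(0,1,2,3), (0,1,2,5), (0,1,3,4), (0,1,4,5), (0,3,1,2), (0,3,1,4),
    (0,3,2,5), (0,3,4,5), (0,5,1,2), (0,5,1,4), (0,5,2,3), (0,5,3,4),
    (1,2,3,4), (1,2,4,5), (1,4,2,3), (1,4,2,5), (2,3,4,5), (2,5,3,4)] :: (nat \<times> nat \<times> nat \<times> nat) list"
  have "4 * (n 0 1 2 - n 0 1 5 + n 0 3 1 - n 0 3 5 + n 0 5 1 - n 0 5 4 - n 1 2 0 + n 1 2 3 - n 1 4 0 + n 1 4 2 -
    n 2 3 0 + n 2 3 4 - n 2 5 0 + n 2 5 3 - n 3 4 0 + n 3 4 5 - n 4 5 0 + n 4 5 3) =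
    (\<Sum>(a, b, c, d)\<leftarrow>?ps. F a b c d)"
    by (simp only: list.map sum_list.Cons sum_list.Nil prod.case F_def) algebra
  also have "\<dots> = (\<Sum>(a, b, c, d)\<leftarrow>?ps. S a b c d)"
    by (simp add: FS)
  also have "\<dots> = -6" by (simp add: S_def order_sign_def)
  finally have "4 * (n 0 1 2 - n 0 1 5 + n 0 3 1 - n 0 3 5 + n 0 5 1 - n 0 5 4 - n 1 2 0 + n 1 2 3 - n 1 4 0 + n 1 4 2 -
    n 2 3 0 + n 2 3 4 - n 2 5 0 + n 2 5 3 - n 3 4 0 + n 3 4 5 - n 4 5 0 + n 4 5 3) = -6" .
  moreover have "4 * k \<noteq> (-6 :: int)" for k by presburger
  ultimately show False by blast
qed

section \<open>Minors of plane graphs\<close>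

definition touches :: "'a graph \<Rightarrow> 'a set \<Rightarrow> 'a set \<Rightarrow> bool" where
  "touches G A B \<longleftrightarrow> (\<exists>x\<in>A. \<exists>y\<in>B. {x, y} \<in> edges G)"

text \<open>These are the branch sets: finite nonempty vertex sets inducing a connected subgraph.
  Building them by joining along an edge matches the gluing of path-connected sets in the
  drawing.\<close>

inductive linked :: "'a graph \<Rightarrow> 'a set \<Rightarrow> bool" for G where
  linked_singleton: "v \<in> verts G \<Longrightarrow> linked G {v}"
| linked_Un: "linked G A \<Longrightarrow> linked G B \<Longrightarrow> touches G A B \<Longrightarrow> linked G (A \<union> B)"

lemma linked_nonempty: "linked G W \<Longrightarrow> W \<noteq> {}"
  by (induction rule: linked.induct) auto

lemma linked_subset_verts: "linked G W \<Longrightarrow> W \<subseteq> verts G"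
  by (induction rule: linked.induct) auto

definition drawn :: "'a graph \<Rightarrow> ('a \<Rightarrow> complex) \<Rightarrow> ('a set \<Rightarrow> real \<Rightarrow> complex) \<Rightarrow> 'a set \<Rightarrow> complex set"
  where "drawn G p \<gamma> W = p ` W \<union> (\<Union>e\<in>{e \<in> edges G. e \<subseteq> W}. path_image (\<gamma> e))"

lemma drawn_mono: "A \<subseteq> B \<Longrightarrow> drawn G p \<gamma> A \<subseteq> drawn G p \<gamma> B"
  unfolding drawn_def by blast

lemma drawn_disjoint:
  assumes G: "plane_drawing G p \<gamma>" and AB: "A \<inter> B = {}" "A \<subseteq> verts G" "B \<subseteq> verts G"
  shows "drawn G p \<gamma> A \<inter> drawn G p \<gamma> B = {}"
proof -
  have inj: "inj_on p (verts G)"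
    and ends: "\<And>e. e \<in> edges G \<Longrightarrow> {pathstart (\<gamma> e), pathfinish (\<gamma> e)} = p ` e"
    and verts: "\<And>e. e \<in> edges G \<Longrightarrow> path_image (\<gamma> e) \<inter> p ` verts G = p ` e"
    and arcs: "\<And>e f. e \<in> edges G \<Longrightarrow> f \<in> edges G \<Longrightarrow> e \<noteq> f \<Longrightarrow>
      path_image (\<gamma> e) \<inter> path_image (\<gamma> f) = p ` (e \<inter> f)"
    using G unfolding plane_drawing_def by simp_all
  have 1: "p ` A \<inter> p ` B = {}"
    using inj_on_image_Int [OF inj AB(2,3)] AB(1) by simp
  have 2: "p ` C \<inter> path_image (\<gamma> e) = {}"
    if "e \<in> edges G" "e \<subseteq> D" "C \<inter> D = {}" "C \<subseteq> verts G" "D \<subseteq> verts G" for C D e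
  proof -
    have "p ` C \<inter> path_image (\<gamma> e) \<subseteq> p ` C \<inter> p ` e"
      using equalityD1 [OF verts [OF that(1)]] that(4) by blast
    also have "\<dots> = p ` (C \<inter> e)"
      using that by (intro inj_on_image_Int [OF inj, symmetric]) auto
    also have "\<dots> = {}" using that by auto
    finally show ?thesis by simp
  qed
  have 3: "path_image (\<gamma> e) \<inter> path_image (\<gamma> f) = {}"
    if "e \<in> edges G" "f \<in> edges G" "e \<subseteq> A" "f \<subseteq> B" for e f
  proof -
    have "e \<noteq> {}" using ends [OF that(1)] by auto
    moreover have "e \<inter> f = {}" using that AB by auto
    ultimately have "e \<noteq> f" by auto
    then show ?thesis using arcs [OF that(1,2)] \<open>e \<inter> f = {}\<close> by simp
  qed
  have "z \<notin> drawn G p \<gamma> B" if z: "z \<in> drawn G p \<gamma> A" for z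
  proof
    assume "z \<in> drawn G p \<gamma> B"
    then consider "z \<in> p ` B" | f where "f \<in> edges G" "f \<subseteq> B" "z \<in> path_image (\<gamma> f)"
      unfolding drawn_def by blast
    moreover from z consider "z \<in> p ` A" | e where "e \<in> edges G" "e \<subseteq> A" "z \<in> path_image (\<gamma> e)"
      unfolding drawn_def by blast
    moreover have "B \<inter> A = {}" using AB by auto
    ultimately show False using 1 2 [of _ A B] 2 [of _ B A] 3 AB
      by (metis disjoint_iff)
  qed
  then show ?thesis by blast
qed

lemma linked_drawn:
  assumes G: "plane_drawing G p \<gamma>" and "linked G W"
  shows "\<exists>S. path_connected S \<and> p ` W \<subseteq> S \<and> S \<subseteq> drawn G p \<gamma> W"
  using assms(2)
proof (induction rule: linked.induct)
  case (linked_singleton v)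
  have "path_connected {p v}" by simp
  then show ?case by (intro exI [of _ "{p v}"]) (auto simp: drawn_def)
next
  case (linked_Un A B)
  then obtain S T where S: "path_connected S" "p ` A \<subseteq> S" "S \<subseteq> drawn G p \<gamma> A"
    and T: "path_connected T" "p ` B \<subseteq> T" "T \<subseteq> drawn G p \<gamma> B" by blast
  obtain x y where xy: "x \<in> A" "y \<in> B" "{x, y} \<in> edges G"
    using linked_Un by (auto simp: touches_def)
  let ?c = "path_image (\<gamma> {x, y})"
  have c: "arc (\<gamma> {x, y})" "{pathstart (\<gamma> {x, y}), pathfinish (\<gamma> {x, y})} = {p x, p y}"
    using G xy unfolding plane_drawing_def by auto
  then have pc: "path_connected ?c" "p x \<in> ?c" "p y \<in> ?c"
    using path_connected_path_image arc_imp_path pathstart_in_path_image pathfinish_in_path_image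
    by (metis doubleton_eq_iff)+
  have "p x \<in> S \<inter> ?c" "p y \<in> (S \<union> ?c) \<inter> T"
    using S(2) T(2) xy pc by auto
  then have "path_connected (S \<union> ?c \<union> T)"
    using S(1) T(1) pc(1) by (metis path_connected_Un empty_iff)
  moreover have "S \<union> ?c \<union> T \<subseteq> drawn G p \<gamma> (A \<union> B)"
    using S(3) T(3) drawn_mono [of A "A \<union> B" G p \<gamma>] drawn_mono [of B "A \<union> B" G p \<gamma>] xy
    unfolding drawn_def [of _ _ _ "A \<union> B"] by blast
  ultimately show ?case using S(2) T(2) by (intro exI [of _ "S \<union> ?c \<union> T"]) auto
qed

lemma minor_paths:
  fixes B :: "nat \<Rightarrow> 'a set"
  assumes "planar G"
    and edge: "\<And>a b. E a b \<Longrightarrow> a < n \<and> b < n \<and> touches G (B a) (B b)"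
    and linked: "\<And>a. a < n \<Longrightarrow> linked G (B a)"
    and disj: "\<And>a b. a < n \<Longrightarrow> b < n \<Longrightarrow> a \<noteq> b \<Longrightarrow> B a \<inter> B b = {}"
  shows "\<exists>p g. edge_map E p g"
proof -
  obtain p \<gamma> where G: "plane_drawing G p \<gamma>" using assms(1) unfolding planar_def by blast
  define r where "r a = (SOME x. x \<in> B a)" for a
  have r: "r a \<in> B a" if "a < n" for a
    unfolding r_def using linked_nonempty [OF linked [OF that]] by (simp add: some_in_eq)
  have "\<exists>h. path h \<and> pathstart h = p (r a) \<and> pathfinish h = p (r b) \<and>
      path_image h \<subseteq> drawn G p \<gamma> (B a \<union> B b)" if "E a b" for a b
  proof -
    \<comment> \<open>The union of two touching branch sets is itself a branch set, so one
      connectedness result routes the whole curve. Disjointness of curves is then inherited from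
      disjointness of the regions \<open>drawn\<close>.\<close>
    have "linked G (B a \<union> B b)" using linked.linked_Un linked edge [OF that] by blast
    then obtain S where "path_connected S" "p ` (B a \<union> B b) \<subseteq> S" "S \<subseteq> drawn G p \<gamma> (B a \<union> B b)"
      using linked_drawn [OF G] by blast
    then show ?thesis
      using r edge [OF that] unfolding path_connected_def by (metis (no_types, lifting) Un_iff image_subset_iff order_trans)
  qed
  then obtain g where g: "\<And>a b. E a b \<Longrightarrow> path (g a b) \<and> pathstart (g a b) = p (r a) \<and>
      pathfinish (g a b) = p (r b) \<and> path_image (g a b) \<subseteq> drawn G p \<gamma> (B a \<union> B b)"
    by metis
  have "path_image (g a b) \<inter> path_image (g c d) = {}"
    if E: "E a b" "E c d" and d: "{a, b} \<inter> {c, d} = {}" for a b c d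
  proof -
    have "(B a \<union> B b) \<inter> (B c \<union> B d) = {}"
      using disj [of a c] disj [of a d] disj [of b c] disj [of b d] edge [OF E(1)] edge [OF E(2)] d
      by (simp add: Int_Un_distrib Int_Un_distrib2)
    moreover have "B a \<union> B b \<subseteq> verts G" "B c \<union> B d \<subseteq> verts G"
      using linked_subset_verts [OF linked] edge [OF E(1)] edge [OF E(2)] by auto
    ultimately show ?thesis
      using drawn_disjoint [OF G] g [OF E(1)] g [OF E(2)] by blast
  qed
  then have "edge_map E (\<lambda>a. p (r a)) g"
    using g unfolding edge_map_def by blast
  then show ?thesis by blast
qed

lemma planar_no_K5_minor:
  fixes B :: "nat \<Rightarrow> 'a set"
  assumes "planar G"
    and "\<And>a. a < 5 \<Longrightarrow> linked G (B a)"
    and "\<And>a b. a < b \<Longrightarrow> b < 5 \<Longrightarrow> B a \<inter> B b = {} \<and> touches G (B a) (B b)"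
  shows False
proof -
  have "B a \<inter> B b = {}" if "a < 5" "b < 5" "a \<noteq> b" for a b
    using assms(3) [of a b] assms(3) [of b a] that by (cases "a < b") auto
  then have "\<exists>p g. edge_map (\<lambda>a b. a < b \<and> b < 5) p g"
    using assms by (intro minor_paths [of G _ 5 B]) auto
  then show False using no_K5_map by blast
qed

lemma planar_no_K33_minor:
  fixes B :: "nat \<Rightarrow> 'a set"
  assumes "planar G"
    and "\<And>a. a < 6 \<Longrightarrow> linked G (B a)"
    and "\<And>a b. a < b \<Longrightarrow> b < 6 \<Longrightarrow> B a \<inter> B b = {}"
    and "\<And>a b. a < b \<Longrightarrow> b < 6 \<Longrightarrow> odd (a + b) \<Longrightarrow> touches G (B a) (B b)"
  shows False
proof -
  have "B a \<inter> B b = {}" if "a < 6" "b < 6" "a \<noteq> b" for a b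
    using assms(3) [of a b] assms(3) [of b a] that by (cases "a < b") auto
  then have "\<exists>p g. edge_map (\<lambda>a b. a < b \<and> b < 6 \<and> odd (a + b)) p g"
    using assms by (intro minor_paths [of G _ 6 B]) auto
  then show False using no_K33_map by blast
qed

section \<open>Fractional matchings and the bipartite double cover\<close>

text \<open>Induction on F, without augmenting paths. In a counterexample, deleting e leaves a
  matching and a cover of size at most \<open>m e\<close>, whereas every cover of F is larger than
  \<open>m e\<close>. If no two pairs of F share an end, F is its own matching; otherwise the covers
  belonging to two such pairs can be recombined into covers of F that are too small
  together.\<close>

lemma koenig:
  fixes F :: "('a \<times> 'b) set"
  assumes "finite F"
  shows "\<exists>M X Y. M \<subseteq> F \<and> inj_on fst M \<and> inj_on snd M \<and> finite X \<and> finite Y \<and>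
    F \<subseteq> {(a, b). a \<in> X \<or> b \<in> Y} \<and> card X + card Y \<le> card M"
  using assms
proof (induction F rule: finite_psubset_induct)
  case (psubset F)
  let ?covers = "\<lambda>X Y F. finite X \<and> finite Y \<and> F \<subseteq> {(a, b). a \<in> X \<or> b \<in> Y}"
  show ?case
  proof (rule ccontr)
    assume no: "\<not> ?thesis"
    have "\<exists>m X Y. ?covers X Y (F - {e}) \<and> card X + card Y \<le> m \<and>
        (\<forall>X Y. ?covers X Y F \<longrightarrow> m < card X + card Y)" if "e \<in> F" for e
    proof -
      have "F - {e} \<subset> F" using that by blast
      then obtain M X Y where "M \<subseteq> F - {e}" "inj_on fst M" "inj_on snd M"
        "?covers X Y (F - {e})" "card X + card Y \<le> card M"
        using psubset.IH by meson
      moreover have "card M < card X + card Y" if "?covers X Y F" for X Y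
        using no that calculation(1-3) by (meson Diff_subset linorder_not_less order_trans)
      ultimately show ?thesis by blast
    qed
    then obtain m X Y where XY: "\<And>e. e \<in> F \<Longrightarrow> ?covers (X e) (Y e) (F - {e}) \<and>
        card (X e) + card (Y e) \<le> m e"
      and m: "\<And>e X Y. e \<in> F \<Longrightarrow> ?covers X Y F \<Longrightarrow> m e < card X + card Y"
      by metis
    have uncovered: "fst e \<notin> X e" "snd e \<notin> Y e" if "e \<in> F" for e
    proof -
      have "\<not> ?covers (X e) (Y e) F" using XY [OF that] m [OF that] by (meson linorder_not_less)
      then show "fst e \<notin> X e" "snd e \<notin> Y e" using XY [OF that] by (auto split: prod.splits)
    qed
    \<comment> \<open>Cover counting is submodular: crossing the covers for \<open>e\<close> and \<open>f\<close> yields two covers of \<open>F\<close>,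
      one of which is too small.\<close>
    have False if ef: "e \<in> F" "f \<in> F" "e \<noteq> f" and "fst e = fst f \<or> snd e = snd f" for e f
      using that(4)
    proof
      assume eq: "fst e = fst f"
      then have mem: "snd e \<in> Y f" "snd f \<in> Y e"
        using XY [OF ef(1)] XY [OF ef(2)] uncovered [OF ef(1)] uncovered [OF ef(2)] ef by auto
      \<comment> \<open>A pair other than e and f is covered twice, hence by both recombinations.
        The first also covers e and f by \<open>mem\<close>; the second needs the common end added.
        This costs one, while strictness for both covers would demand an excess of two.\<close>
      have "?covers (X e \<inter> X f) (Y e \<union> Y f) F" "?covers (insert (fst e) (X e \<union> X f)) (Y e \<inter> Y f) F"
        using XY [OF ef(1)] XY [OF ef(2)] mem eq by auto
      note covers = this
      have "m e < card (X e \<inter> X f) + card (Y e \<union> Y f)"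
        "m f < card (insert (fst e) (X e \<union> X f)) + card (Y e \<inter> Y f)"
        by (rule m [OF ef(1) covers(1)], rule m [OF ef(2) covers(2)])
      moreover have "card (insert (fst e) (X e \<union> X f)) \<le> Suc (card (X e \<union> X f))"
        by (simp add: card_insert_le_m1 card_insert_if XY [OF ef(1)] XY [OF ef(2)])
      ultimately show False
        using card_Un_Int [of "X e" "X f"] card_Un_Int [of "Y e" "Y f"] XY [OF ef(1)] XY [OF ef(2)]
        by linarith
    next
      assume eq: "snd e = snd f"
      then have mem: "fst e \<in> X f" "fst f \<in> X e"
        using XY [OF ef(1)] XY [OF ef(2)] uncovered [OF ef(1)] uncovered [OF ef(2)] ef by auto
      have "?covers (X e \<union> X f) (Y e \<inter> Y f) F" "?covers (X e \<inter> X f) (insert (snd e) (Y e \<union> Y f)) F"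
        using XY [OF ef(1)] XY [OF ef(2)] mem eq by auto
      note covers = this
      have "m e < card (X e \<union> X f) + card (Y e \<inter> Y f)"
        "m f < card (X e \<inter> X f) + card (insert (snd e) (Y e \<union> Y f))"
        by (rule m [OF ef(1) covers(1)], rule m [OF ef(2) covers(2)])
      moreover have "card (insert (snd e) (Y e \<union> Y f)) \<le> Suc (card (Y e \<union> Y f))"
        by (simp add: card_insert_le_m1 card_insert_if XY [OF ef(1)] XY [OF ef(2)])
      ultimately show False
        using card_Un_Int [of "X e" "X f"] card_Un_Int [of "Y e" "Y f"] XY [OF ef(1)] XY [OF ef(2)]
        by linarith
    qed
    then have "inj_on fst F" "inj_on snd F" unfolding inj_on_def by blast+
    moreover have "?covers (fst ` F) {} F" using psubset.hyps by force
    moreover have "card (fst ` F) + card {} \<le> card F" by (simp add: card_image_le psubset.hyps)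
    ultimately have ?thesis
      by (intro exI [of _ F] exI [of _ "fst ` F"] exI [of _ "{}"]) simp
    then show False using no by blast
  qed
qed

text \<open>This is a matching of the bipartite double cover. Both orientations of an edge may occur
  and then stand for weight 1; a single orientation stands for weight 1/2.\<close>

definition arc_matching :: "'a set set \<Rightarrow> ('a \<times> 'a) set \<Rightarrow> bool" where
  "arc_matching R M \<longleftrightarrow> (\<forall>(x, y)\<in>M. {x, y} \<in> R) \<and> inj_on fst M \<and> inj_on snd M"

lemma finite_Union_pairs:
  assumes "finite R" "\<forall>e\<in>R. card e = 2"
  shows "finite (\<Union>R)"
proof (rule finite_Union [OF assms(1)])
  fix e assume "e \<in> R"
  then show "finite e" using assms(2) by (intro card_ge_0_finite) simp
qed

lemma finite_arcs:
  assumes "finite R" "\<forall>e\<in>R. card e = 2"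
  shows "finite {(x, y). {x, y} \<in> R}"
proof -
  have "finite (\<Union>R \<times> \<Union>R)" using finite_Union_pairs [OF assms] by blast
  then show ?thesis by (rule rev_finite_subset) auto
qed

text \<open>Weak duality: \<open>c v / 2\<close> is a fractional vertex cover. Both orientations of
  an edge have to be covered, so the values of c at its two ends add up to at least 2.\<close>

lemma frac_matching_le_cover:
  assumes "finite R" and R2: "\<forall>e\<in>R. card e = 2"
    and g: "fractional_matching (edge_induced R) g"
    and XY: "finite X" "finite Y" "{(x, y). {x, y} \<in> R} \<subseteq> {(x, y). x \<in> X \<or> y \<in> Y}"
  shows "(\<Sum>e\<in>R. g e) \<le> real (card X + card Y) / 2"
proof -
  define c where "c v = (if v \<in> X then 1 else 0) + (if v \<in> Y then 1 else (0::real))" for v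
  have fin: "finite (\<Union>R)" using assms(1,2) by (rule finite_Union_pairs)
  have "2 \<le> (\<Sum>v\<in>{v \<in> \<Union>R. v \<in> e}. c v)" if e: "e \<in> R" for e
  proof -
    obtain x y where xy: "e = {x, y}" "x \<noteq> y" using R2 e by (meson card_2_iff)
    moreover from this have "{y, x} \<in> R" using e by (simp add: insert_commute)
    ultimately have "x \<in> X \<or> y \<in> Y" "y \<in> X \<or> x \<in> Y" using XY(3) e by blast+
    moreover have "{v \<in> \<Union>R. v \<in> e} = {x, y}" using xy e by auto
    ultimately show ?thesis using xy by (auto simp: c_def)
  qed
  then have "(\<Sum>e\<in>R. g e * 2) \<le> (\<Sum>e\<in>R. g e * (\<Sum>v\<in>{v \<in> \<Union>R. v \<in> e}. c v))"
    using g by (intro sum_mono mult_left_mono) (auto simp: fractional_matching_def edge_induced_def)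
  also have "\<dots> = (\<Sum>e\<in>R. \<Sum>v\<in>{v \<in> \<Union>R. v \<in> e}. c v * g e)"
    by (simp add: sum_distrib_left mult.commute)
  also have "\<dots> = (\<Sum>v\<in>\<Union>R. \<Sum>e\<in>{e \<in> R. v \<in> e}. c v * g e)"
    by (rule sum.swap_restrict) (use assms(1) fin in auto)
  also have "\<dots> = (\<Sum>v\<in>\<Union>R. c v * (\<Sum>e\<in>{e \<in> R. v \<in> e}. g e))"
    by (simp add: sum_distrib_left)
  also have "\<dots> \<le> (\<Sum>v\<in>\<Union>R. c v * 1)"
    using g by (intro sum_mono mult_left_mono) (auto simp: fractional_matching_def edge_induced_def c_def)
  also have "\<dots> = real (card (\<Union>R \<inter> X)) + real (card (\<Union>R \<inter> Y))"
    using fin by (simp add: c_def sum.distrib flip: sum.inter_restrict)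
  also have "\<dots> \<le> real (card X) + real (card Y)"
    using XY by (intro add_mono of_nat_mono card_mono) auto
  finally show ?thesis by (simp flip: sum_distrib_right)
qed

lemma frac_matching_number_le_arc_matching:
  assumes "finite R" "\<forall>e\<in>R. card e = 2"
  shows "\<exists>M. arc_matching R M \<and> finite M \<and> frac_matching_number (edge_induced R) \<le> card M / 2"
proof -
  let ?F = "{(x, y). {x, y} \<in> R}"
  obtain M X Y where M: "M \<subseteq> ?F" "inj_on fst M" "inj_on snd M"
    and XY: "finite X" "finite Y" "?F \<subseteq> {(x, y). x \<in> X \<or> y \<in> Y}" and le: "card X + card Y \<le> card M"
    using koenig [OF finite_arcs [OF assms]] by metis
  have "frac_matching_number (edge_induced R) \<le> real (card X + card Y) / 2"
    unfolding frac_matching_number_def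
  proof (rule cSUP_least)
    have "fractional_matching (edge_induced R) (\<lambda>_. 0)" by (simp add: fractional_matching_def)
    then show "{g. fractional_matching (edge_induced R) g} \<noteq> {}" by blast
  qed (use frac_matching_le_cover [OF assms _ XY] in \<open>auto simp: edge_induced_def\<close>)
  also have "\<dots> \<le> card M / 2" using le by simp
  finally have "frac_matching_number (edge_induced R) \<le> card M / 2" .
  moreover have "arc_matching R M" using M unfolding arc_matching_def by auto
  ultimately show ?thesis using finite_subset [OF M(1) finite_arcs [OF assms]] by blast
qed

text \<open>Giving each edge half the number of its orientations in M yields a fractional matching,
  because a vertex is the tail of at most one arc and the head of at most one.\<close>

lemma arc_matching_le_frac_matching_number:
  assumes "finite R" and R2: "\<forall>e\<in>R. card e = 2" and M: "arc_matching R M"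
  shows "card M / 2 \<le> frac_matching_number (edge_induced R)"
proof -
  let ?pr = "\<lambda>(x, y). {x, y}"
  have fin: "finite M"
    using M finite_arcs [OF assms(1,2)] unfolding arc_matching_def by (elim finite_subset[rotated] conjE) auto
  define g where "g e = card {a \<in> M. ?pr a = e} / 2" for e
  have g_sum: "(\<Sum>e\<in>E. g e) = card {a \<in> M. ?pr a \<in> E} / 2" if "E \<subseteq> R" for E
  proof -
    have "finite E" using that assms(1) finite_subset by blast
    then have "(\<Sum>e\<in>E. sum (\<lambda>_. 1) {a \<in> {a \<in> M. ?pr a \<in> E}. ?pr a = e}) = sum (\<lambda>_. 1::real) {a \<in> M. ?pr a \<in> E}"
      using fin by (intro sum.group) auto
    moreover have "{a \<in> {a \<in> M. ?pr a \<in> E}. ?pr a = e} = {a \<in> M. ?pr a = e}" if "e \<in> E" for e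
      using that by auto
    ultimately show ?thesis unfolding g_def by (simp flip: sum_divide_distrib)
  qed
  have "fractional_matching (edge_induced R) g"
    unfolding fractional_matching_def edge_induced_def
  proof (intro conjI ballI; clarsimp)
    fix v e assume "v \<in> e" "e \<in> R"
    have "card {a \<in> M. fst a = v} \<le> Suc 0" "card {a \<in> M. snd a = v} \<le> Suc 0"
      using M fin unfolding arc_matching_def inj_on_def
      by (subst card_le_Suc0_iff_eq; auto)+
    moreover have "card {a \<in> M. ?pr a \<in> {e \<in> R. v \<in> e}} \<le> card ({a \<in> M. fst a = v} \<union> {a \<in> M. snd a = v})"
      using fin by (intro card_mono) auto
    ultimately have "card {a \<in> M. ?pr a \<in> {e \<in> R. v \<in> e}} \<le> 2"
      using card_Un_le [of "{a \<in> M. fst a = v}" "{a \<in> M. snd a = v}"] by linarith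
    then show "(\<Sum>e | e \<in> R \<and> v \<in> e. g e) \<le> 1"
      by (subst g_sum) auto
  qed (simp add: g_def)
  then have "(\<Sum>e\<in>R. g e) \<le> frac_matching_number (edge_induced R)"
  proof -
    assume g: "fractional_matching (edge_induced R) g"
    have "finite (\<Union>R)" using assms(1,2) by (rule finite_Union_pairs)
    \<comment> \<open>Taking all vertices on both sides is a cover; it serves only to bound the set
      whose supremum is formed.\<close>
    then have "(\<Sum>e\<in>R. h e) \<le> real (card (\<Union>R) + card (\<Union>R)) / 2"
      if "fractional_matching (edge_induced R) h" for h
      using that by (intro frac_matching_le_cover [OF assms(1,2)]) auto
    then have "bdd_above ((\<lambda>h. \<Sum>e\<in>R. h e) ` {h. fractional_matching (edge_induced R) h})"
      by (intro bdd_aboveI2) auto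
    then show ?thesis
      using g unfolding frac_matching_number_def by (intro cSUP_upper2) (auto simp: edge_induced_def)
  qed
  moreover have "{a \<in> M. ?pr a \<in> R} = M" using M unfolding arc_matching_def by auto
  ultimately show ?thesis using g_sum [of R] by simp
qed

section \<open>Packings of edges and odd cycles\<close>

definition odd_cycle :: "'a set set \<Rightarrow> 'a list \<Rightarrow> bool" where
  "odd_cycle R C \<longleftrightarrow> odd (length C) \<and> 3 \<le> length C \<and>
     (\<forall>i<length C. {C ! i, C ! (Suc i mod length C)} \<in> R)"

text \<open>\<open>odd_cycle\<close> describes a closed walk along a list; its vertices become
  distinct, within and across cycles, through the condition on \<open>concat Cs\<close>.\<close>

definition packing :: "'a set set \<Rightarrow> 'a set set \<Rightarrow> 'a list list \<Rightarrow> bool" where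
  "packing R P Cs \<longleftrightarrow> finite P \<and> P \<subseteq> R \<and> disjoint P \<and> (\<forall>C\<in>set Cs. odd_cycle R C) \<and>
     distinct (concat Cs) \<and> set (concat Cs) \<inter> \<Union>P = {}"

lemma path_matching:
  assumes "distinct vs" "successively (\<lambda>x y. {x, y} \<in> R) vs"
  shows "\<exists>P. P \<subseteq> R \<and> finite P \<and> disjoint P \<and> \<Union>P \<subseteq> set vs \<and> card P = length vs div 2"
  using assms
proof (induction vs rule: induct_list012)
  case (3 x y zs)
  then have "successively (\<lambda>x y. {x, y} \<in> R) zs" by (auto simp: successively_Cons)
  with 3 obtain P where P: "P \<subseteq> R" "finite P" "disjoint P" "\<Union>P \<subseteq> set zs" "card P = length zs div 2"
    by auto
  have "x \<notin> \<Union>P" "y \<notin> \<Union>P" using P 3 by auto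
  then have "{x, y} \<notin> P" "disjoint (insert {x, y} P)"
    using P(3) by (auto simp: pairwise_insert disjnt_def)
  then show ?case using P 3 by (intro exI [of _ "insert {x, y} P"]) auto
qed (auto intro: exI [of _ "{}"])

lemma odd_cycle_matching:
  assumes "distinct C" "odd_cycle R C"
  shows "\<exists>P. P \<subseteq> R \<and> finite P \<and> disjoint P \<and> \<Union>P \<subseteq> set C \<and> card P = length C div 2"
proof (rule path_matching [OF assms(1)])
  have "{C ! i, C ! Suc i} \<in> R" if "Suc i < length C" for i
    using assms(2) that unfolding odd_cycle_def by (metis Suc_lessD mod_less)
  then show "successively (\<lambda>x y. {x, y} \<in> R) C"
    by (simp add: successively_conv_nth)
qed

lemma packing_Un:
  assumes "packing R P Cs" "Q \<subseteq> R" "finite Q" "disjoint Q" "{} \<notin> R"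
    and "\<Union>Q \<inter> (\<Union>P \<union> set (concat Cs)) = {}"
  shows "packing R (P \<union> Q) Cs \<and> card (P \<union> Q) = card P + card Q"
proof -
  have "p \<inter> q = {}" if "p \<in> P" "q \<in> Q" for p q using assms(6) that by blast
  then have PQ: "p \<inter> q = {}" "q \<inter> p = {}" if "p \<in> P" "q \<in> Q" for p q
    using that by auto
  have "disjoint P" using assms(1) unfolding packing_def by blast
  have "disjoint (P \<union> Q)"
  proof (rule disjointI)
    fix A B assume "A \<in> P \<union> Q" "B \<in> P \<union> Q" "A \<noteq> B"
    then show "A \<inter> B = {}"
      using PQ disjointD [OF \<open>disjoint P\<close>] disjointD [OF assms(4)] by (elim UnE) simp_all
  qed
  moreover have "P \<inter> Q = {}"
  proof -
    have "e = {}" if "e \<in> P" "e \<in> Q" for e using assms(6) that by blast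
    then show ?thesis using assms(2,5) by blast
  qed
  moreover have "set (concat Cs) \<inter> \<Union>(P \<union> Q) = {}"
    using assms(1,6) unfolding packing_def by blast
  ultimately show ?thesis using assms unfolding packing_def by (simp add: card_Un_disjoint)
qed

text \<open>An odd cycle minus a vertex has a perfect matching. Trading a cycle for this matching
  preserves the number of disjoint edges obtainable from the packing.\<close>

lemma packing_drop_cycle:
  assumes "packing R P (C # Cs)" "{} \<notin> R"
  shows "\<exists>P'. packing R P' Cs \<and> card P' = card P + length C div 2"
proof -
  have C: "distinct C" "odd_cycle R C" "set C \<inter> set (concat Cs) = {}" "set C \<inter> \<Union>P = {}"
    and P: "packing R P Cs"
    using assms(1) unfolding packing_def by auto
  obtain Q where Q: "Q \<subseteq> R \<and> finite Q \<and> disjoint Q \<and> \<Union>Q \<subseteq> set C \<and> card Q = length C div 2"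
    using odd_cycle_matching [OF C(1,2)] ..
  then have "\<Union>Q \<inter> (\<Union>P \<union> set (concat Cs)) = {}" using C(3,4) by blast
  then show ?thesis using packing_Un [OF P, of Q] assms(2) Q by (intro exI [of _ "P \<union> Q"]) simp
qed

lemma longest_path:
  fixes M :: "('a \<times> 'a) set"
  assumes "finite M" "M \<noteq> {}" and loop: "\<And>x. (x, x) \<notin> M"
  obtains vs where "distinct vs" "successively (\<lambda>x y. (x, y) \<in> M) vs" "2 \<le> length vs" "set vs \<subseteq> Field M"
    "\<And>ws. distinct ws \<Longrightarrow> successively (\<lambda>x y. (x, y) \<in> M) ws \<Longrightarrow> set ws \<subseteq> Field M \<Longrightarrow>
       length ws \<le> length vs"
proof -
  let ?P = "\<lambda>vs. distinct vs \<and> successively (\<lambda>x y. (x, y) \<in> M) vs \<and> set vs \<subseteq> Field M"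
  obtain x y where xy: "(x, y) \<in> M" using assms(2) by auto
  have Pxy: "?P [x, y]" using xy loop by (auto simp: Field_def)
  have "\<forall>vs. ?P vs \<longrightarrow> length vs < Suc (card (Field M))"
    using card_mono [OF finite_Field [OF assms(1)]] by (metis distinct_card le_imp_less_Suc)
  then obtain vs where vs: "?P vs" "\<And>ws. ?P ws \<Longrightarrow> length ws \<le> length vs"
    using ex_has_greatest_nat [of ?P "[x, y]" length "Suc (card (Field M))", OF Pxy] by metis
  have "2 \<le> length vs" using vs(2) [OF Pxy] by simp
  then show thesis using that [of vs] vs by simp
qed

text \<open>With in- and outdegrees at most 1, M splits into directed paths and cycles, and the
  vertices of a longest path form a whole component. An odd directed cycle is kept; any other
  component on n vertices has at most \<open>2 * (n div 2)\<close> arcs and is replaced by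
  \<open>n div 2\<close> disjoint edges. Induction removes one component at a time.\<close>

lemma arc_matching_packing:
  assumes "finite M" "arc_matching R M" and R2: "\<forall>e\<in>R. card e = 2"
  shows "\<exists>P Cs. packing R P Cs \<and> \<Union>P \<union> set (concat Cs) \<subseteq> Field M \<and>
    card M \<le> 2 * card P + length (concat Cs)"
  using assms(1,2)
proof (induction M rule: finite_psubset_induct)
  case (psubset M)
  have R0: "{} \<notin> R" using R2 by auto
  have loop: "(x, x) \<notin> M" for x using psubset.prems R2 unfolding arc_matching_def by fastforce
  show ?case
  proof (cases "M = {}")
    case True
    have "packing R {} []" by (simp add: packing_def)
    then show ?thesis using True by (intro exI [of _ "{}"] exI [of _ "[]"]) simp
  next
    case False
    obtain vs where dist: "distinct vs" and path: "successively (\<lambda>x y. (x, y) \<in> M) vs"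
      and n2: "2 \<le> length vs" and field: "set vs \<subseteq> Field M"
      and longest: "\<And>ws. distinct ws \<Longrightarrow> successively (\<lambda>x y. (x, y) \<in> M) ws \<Longrightarrow>
        set ws \<subseteq> Field M \<Longrightarrow> length ws \<le> length vs"
      using longest_path [OF psubset.hyps(1) False loop] by metis
    define n where "n = length vs"
    have ne: "vs \<noteq> []" using n2 by auto
    have step: "(vs ! i, vs ! Suc i) \<in> M" if "Suc i < n" for i
      using path that unfolding n_def successively_conv_nth by blast
    have fsteq: "y = z" if "(x, y) \<in> M" "(x, z) \<in> M" for x y z
      using psubset.prems that unfolding arc_matching_def inj_on_def by fastforce
    have sndeq: "x = z" if "(x, y) \<in> M" "(z, y) \<in> M" for x y z
      using psubset.prems that unfolding arc_matching_def inj_on_def by fastforce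
    \<comment> \<open>Only the last vertex is in question. Maximality keeps its arc inside the path,
      and every vertex but the first already has its incoming arc, so the arc closes the
      cycle.\<close>
    have out: "y = vs ! (Suc i mod n)" if i: "i < n" and a: "(vs ! i, y) \<in> M" for i y
    proof (cases "Suc i < n")
      case True
      then show ?thesis using fsteq [OF a step] by simp
    next
      case False
      then have i': "i = n - 1" using i by simp
      have "y \<in> set vs"
      proof (rule ccontr)
        assume "y \<notin> set vs"
        moreover have "last vs = vs ! i" using i' ne n_def by (simp add: last_conv_nth)
        moreover have "y \<in> Field M" using a by (auto simp: Field_def)
        ultimately have "length (vs @ [y]) \<le> length vs"
          using dist path field a by (intro longest) (auto simp: successively_append_iff)
        then show False by simp
      qed
      then obtain j where j: "j < n" "y = vs ! j" unfolding n_def by (metis in_set_conv_nth)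
      have "j = 0"
      proof (rule ccontr)
        assume "j \<noteq> 0"
        then have "vs ! (j - 1) = vs ! i" using sndeq [OF step [of "j - 1"]] a j by simp
        then have "j - 1 = i" using dist j i n_def by (metis less_imp_diff_less nth_eq_iff_index_eq)
        then show False using i' j \<open>j \<noteq> 0\<close> by linarith
      qed
      then show ?thesis using j i' i by simp
    qed
    have incoming: "x \<in> set vs" if a: "(x, vs ! j) \<in> M" and j: "j < n" for x j
    proof (cases j)
      case 0
      show ?thesis
      proof (rule ccontr)
        assume "x \<notin> set vs"
        moreover have "hd vs = vs ! j" using 0 ne by (simp add: hd_conv_nth)
        moreover have "x \<in> Field M" using a by (auto simp: Field_def)
        ultimately have "length (x # vs) \<le> length vs"
          using dist path field a by (intro longest) (auto simp: successively_Cons)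
        then show False by simp
      qed
    next
      case (Suc k)
      then have "x = vs ! k" using sndeq [OF a] step [of k] j by simp
      then show ?thesis using j Suc n_def by simp
    qed
    define M0 where "M0 = {(x, y) \<in> M. x \<in> set vs \<or> y \<in> set vs}"
    have M0: "M0 \<subseteq> (\<lambda>i. (vs ! i, vs ! (Suc i mod n))) ` {..<n}"
    proof
      fix a assume "a \<in> M0"
      then obtain x y where a: "a = (x, y)" "(x, y) \<in> M" "x \<in> set vs \<or> y \<in> set vs"
        unfolding M0_def by blast
      then have "x \<in> set vs" using incoming n_def by (metis in_set_conv_nth)
      then obtain i where "i < n" "x = vs ! i" unfolding n_def by (metis in_set_conv_nth)
      then show "a \<in> (\<lambda>i. (vs ! i, vs ! (Suc i mod n))) ` {..<n}" using out a by blast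
    qed
    have "vs ! 0 \<in> set vs" "(vs ! 0, vs ! Suc 0) \<in> M" using n2 ne step [of 0] n_def by simp_all
    then have "M - M0 \<subset> M" unfolding M0_def by blast
    moreover have "arc_matching R (M - M0)"
      using psubset.prems unfolding arc_matching_def by (auto intro: inj_on_diff)
    ultimately obtain P Cs where P: "packing R P Cs" "\<Union>P \<union> set (concat Cs) \<subseteq> Field (M - M0)"
      and count: "card (M - M0) \<le> 2 * card P + length (concat Cs)"
      using psubset.IH by metis
    have off: "Field (M - M0) \<inter> set vs = {}" unfolding M0_def Field_def by blast
    have sub: "Field (M - M0) \<subseteq> Field M" by (rule mono_Field) blast
    have card: "card M = card (M - M0) + card M0"
    proof -
      have "M0 \<subseteq> M" unfolding M0_def by blast
      then show ?thesis
        using psubset.hyps(1) by (simp add: card_Diff_subset card_mono finite_subset)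
    qed
    have R: "{vs ! i, vs ! (Suc i mod n)} \<in> R" if "(vs ! i, vs ! (Suc i mod n)) \<in> M" for i
      using that psubset.prems unfolding arc_matching_def by auto
    show ?thesis
    proof (cases "odd n \<and> (vs ! (n - 1), vs ! 0) \<in> M")
      case True
      have "(vs ! i, vs ! (Suc i mod n)) \<in> M" if "i < n" for i
      proof (cases "Suc i = n")
        case True
        then have "i = n - 1" by simp
        then show ?thesis using \<open>odd n \<and> _\<close> True by simp
      next
        case False
        then show ?thesis using step that by simp
      qed
      then have "odd_cycle R vs"
        using True n2 R unfolding odd_cycle_def n_def [symmetric] by (auto elim: oddE)
      then have "packing R P (vs # Cs)"
        using P off dist unfolding packing_def by auto
      moreover have "card M0 \<le> n"
        using surj_card_le [OF finite_lessThan M0] by simp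
      ultimately show ?thesis
        using P(2) sub field count card by (intro exI [of _ P] exI [of _ "vs # Cs"]) (auto simp: n_def)
    next
      case False
      have "successively (\<lambda>x y. {x, y} \<in> R) vs"
        using psubset.prems path unfolding arc_matching_def successively_conv_nth by auto
      then obtain Q where Q: "Q \<subseteq> R" "finite Q" "disjoint Q" "\<Union>Q \<subseteq> set vs" "card Q = n div 2"
        using path_matching [OF dist] n_def by metis
      have "packing R (P \<union> Q) Cs" "card (P \<union> Q) = card P + card Q"
        using packing_Un [OF P(1) Q(1-3) R0] P(2) Q(4) off by blast+
      \<comment> \<open>For even n even a closed directed cycle is accounted for by its n / 2 edges.
        For odd n one arc would be too many, but here the closing arc is absent.\<close>
      moreover have "card M0 \<le> 2 * (n div 2)"
      proof (cases "odd n")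
        case True
        have "M0 \<subseteq> (\<lambda>i. (vs ! i, vs ! (Suc i mod n))) ` {..<n - 1}"
        proof
          fix a assume a: "a \<in> M0"
          then obtain i where i: "i < n" "a = (vs ! i, vs ! (Suc i mod n))" using M0 by blast
          moreover have "i \<noteq> n - 1"
          proof
            assume "i = n - 1"
            then have "a = (vs ! (n - 1), vs ! 0)" using i by simp
            then show False using a False True unfolding M0_def by blast
          qed
          ultimately show "a \<in> (\<lambda>i. (vs ! i, vs ! (Suc i mod n))) ` {..<n - 1}" by auto
        qed
        then have "card M0 \<le> n - 1"
          using surj_card_le [OF finite_lessThan] by fastforce
        then show ?thesis using True by (auto elim: oddE)
      next
        case False
        have "card M0 \<le> n"
          using surj_card_le [OF finite_lessThan M0] by simp
        then show ?thesis using False by simp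
      qed
      moreover have "\<Union>(P \<union> Q) \<union> set (concat Cs) \<subseteq> Field M" using P(2) Q(4) sub field by blast
      ultimately show ?thesis
        using count card Q(5) by (intro exI [of _ "P \<union> Q"] exI [of _ Cs]) auto
    qed
  qed
qed

section \<open>Subgraphs of edge-induced graphs\<close>

lemma contains_subgraph_iff:
  assumes A: "simple_graph A"
  shows "contains_subgraph H A \<longleftrightarrow>
    (\<exists>\<phi>. inj_on \<phi> (verts A) \<and> \<phi> ` verts A \<subseteq> verts H \<and> (\<forall>e\<in>edges A. \<phi> ` e \<in> edges H))"
proof
  assume "contains_subgraph H A"
  then obtain S \<phi> where "verts S \<subseteq> verts H" "edges S \<subseteq> edges H" "bij_betw \<phi> (verts A) (verts S)"
      "edges S = (\<lambda>e. \<phi> ` e) ` edges A"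
    unfolding contains_subgraph_def subgraph_def isomorphic_def by blast
  then show "\<exists>\<phi>. inj_on \<phi> (verts A) \<and> \<phi> ` verts A \<subseteq> verts H \<and> (\<forall>e\<in>edges A. \<phi> ` e \<in> edges H)"
    unfolding bij_betw_def by (intro exI [of _ \<phi>]) auto
next
  assume "\<exists>\<phi>. inj_on \<phi> (verts A) \<and> \<phi> ` verts A \<subseteq> verts H \<and> (\<forall>e\<in>edges A. \<phi> ` e \<in> edges H)"
  then obtain \<phi> where \<phi>: "inj_on \<phi> (verts A)" "\<phi> ` verts A \<subseteq> verts H" "\<forall>e\<in>edges A. \<phi> ` e \<in> edges H"
    by blast
  let ?S = "(\<phi> ` verts A, (\<lambda>e. \<phi> ` e) ` edges A)"
  have "card (\<phi> ` e) = 2" "\<phi> ` e \<subseteq> \<phi> ` verts A" if "e \<in> edges A" for e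
    using A \<phi>(1) that card_image [OF inj_on_subset [OF \<phi>(1), of e]] unfolding simple_graph_def by auto
  then have "simple_graph ?S" using A unfolding simple_graph_def by auto
  then have "subgraph ?S H" using \<phi> unfolding subgraph_def by auto
  moreover have "isomorphic A ?S"
    using \<phi>(1) unfolding isomorphic_def bij_betw_def by auto
  ultimately show "contains_subgraph H A" unfolding contains_subgraph_def by blast
qed

text \<open>In a finite simple graph \<sigma> is a permutation of the vertices whose orbits are
  edges or cycles spanning A. Its arcs \<open>(v, \<sigma> v)\<close> form an arc matching with one
  arc per vertex, and each of the three graphs sought has nine vertices.\<close>

definition has_cycle_cover :: "'a graph \<Rightarrow> bool" where
  "has_cycle_cover A \<longleftrightarrow> (\<exists>\<sigma>. inj_on \<sigma> (verts A) \<and> (\<forall>v\<in>verts A. {v, \<sigma> v} \<in> edges A))"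

lemma has_cycle_cover_verts: "has_cycle_cover A \<Longrightarrow> verts A \<subseteq> \<Union>(edges A)"
  unfolding has_cycle_cover_def by blast

lemma arc_matching_of_contains:
  assumes A: "simple_graph A" and H: "contains_subgraph (edge_induced R) A" and "has_cycle_cover A"
  shows "\<exists>M. arc_matching R M \<and> card M = card (verts A)"
proof -
  obtain \<sigma> where \<sigma>: "inj_on \<sigma> (verts A)" "\<And>v. v \<in> verts A \<Longrightarrow> {v, \<sigma> v} \<in> edges A"
    using assms(3) unfolding has_cycle_cover_def by blast
  obtain \<phi> where \<phi>: "inj_on \<phi> (verts A)" "\<forall>e\<in>edges A. \<phi> ` e \<in> R"
    using H unfolding contains_subgraph_iff [OF A] edge_induced_def by auto
  have mem: "\<sigma> v \<in> verts A" if "v \<in> verts A" for v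
    using A \<sigma>(2) [OF that] unfolding simple_graph_def by auto
  let ?M = "(\<lambda>v. (\<phi> v, \<phi> (\<sigma> v))) ` verts A"
  have "{\<phi> v, \<phi> (\<sigma> v)} \<in> R" if "v \<in> verts A" for v
    using bspec [OF \<phi>(2) \<sigma>(2) [OF that]] by simp
  moreover have "inj_on fst ?M" "inj_on snd ?M"
    using mem by (auto intro!: inj_onI simp: inj_on_eq_iff [OF \<phi>(1)] inj_on_eq_iff [OF \<sigma>(1)])
  ultimately have "arc_matching R ?M"
    unfolding arc_matching_def by auto
  moreover have "card ?M = card (verts A)"
    using \<phi>(1) by (intro card_image) (auto simp: inj_on_def)
  ultimately show ?thesis by blast
qed

section \<open>Cycle covers of the three target graphs\<close>

lemma simple_complete_graph: "simple_graph (complete_graph k)"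
  unfolding simple_graph_def complete_graph_def by (auto simp: card_2_iff)

lemma simple_cycle_graph: "2 \<le> k \<Longrightarrow> simple_graph (cycle_graph k)"
  unfolding simple_graph_def cycle_graph_def by (auto simp: card_insert_if mod_Suc)

lemma simple_disjoint_union: "simple_graph A \<Longrightarrow> simple_graph B \<Longrightarrow> simple_graph (disjoint_union A B)"
  unfolding simple_graph_def disjoint_union_def by (auto simp: card_image)

lemma simple_copies: "simple_graph A \<Longrightarrow> simple_graph (copies n A)"
  unfolding simple_graph_def copies_def by (auto simp: card_image inj_on_def)

lemma inj_on_Suc_mod: "inj_on (\<lambda>j. Suc j mod k) {..<k}"
  by (auto simp: inj_on_def mod_Suc split: if_splits)

lemma cycle_cover_cycle_graph: "has_cycle_cover (cycle_graph k)"
  unfolding has_cycle_cover_def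
  by (rule exI [of _ "\<lambda>j. Suc j mod k"]) (use inj_on_Suc_mod in \<open>auto simp: cycle_graph_def\<close>)

lemma cycle_cover_complete_graph: "2 \<le> k \<Longrightarrow> has_cycle_cover (complete_graph k)"
  unfolding has_cycle_cover_def
proof (rule exI [of _ "\<lambda>j. Suc j mod k"], intro conjI ballI)
  assume "2 \<le> k"
  fix j assume "j \<in> verts (complete_graph k)"
  then have "j < k" "Suc j mod k < k" "j \<noteq> Suc j mod k"
    using \<open>2 \<le> k\<close> by (auto simp: complete_graph_def mod_Suc)
  then show "{j, Suc j mod k} \<in> edges (complete_graph k)" unfolding complete_graph_def snd_conv by blast
qed (use inj_on_Suc_mod in \<open>simp add: complete_graph_def\<close>)

lemma edges_disjoint_unionI1:
  assumes "e \<in> edges A" shows "Inl ` e \<in> edges (disjoint_union A B)"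
  unfolding disjoint_union_def snd_conv
  by (rule UnI1, rule imageI [of e "edges A" "image Inl"], rule assms)

lemma edges_disjoint_unionI2:
  assumes "e \<in> edges B" shows "Inr ` e \<in> edges (disjoint_union A B)"
  unfolding disjoint_union_def snd_conv
  by (rule UnI2, rule imageI [of e "edges B" "image Inr"], rule assms)

lemma verts_disjoint_union_iff:
  "Inl a \<in> verts (disjoint_union A B) \<longleftrightarrow> a \<in> verts A"
  "Inr b \<in> verts (disjoint_union A B) \<longleftrightarrow> b \<in> verts B"
  by (auto simp: disjoint_union_def)

lemma cycle_cover_disjoint_union:
  assumes "has_cycle_cover A" "has_cycle_cover B"
  shows "has_cycle_cover (disjoint_union A B)"
proof -
  obtain \<sigma> where \<sigma>: "inj_on \<sigma> (verts A)" "\<And>v. v \<in> verts A \<Longrightarrow> {v, \<sigma> v} \<in> edges A"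
    using assms(1) unfolding has_cycle_cover_def by blast
  obtain \<tau> where \<tau>: "inj_on \<tau> (verts B)" "\<And>v. v \<in> verts B \<Longrightarrow> {v, \<tau> v} \<in> edges B"
    using assms(2) unfolding has_cycle_cover_def by blast
  have "inj_on (map_sum \<sigma> \<tau>) (verts (disjoint_union A B))"
  proof (rule inj_onI)
    fix x y assume "x \<in> verts (disjoint_union A B)" "y \<in> verts (disjoint_union A B)"
      "map_sum \<sigma> \<tau> x = map_sum \<sigma> \<tau> y"
    then show "x = y"
      by (cases x; cases y)
        (simp_all add: verts_disjoint_union_iff inj_on_eq_iff [OF \<sigma>(1)] inj_on_eq_iff [OF \<tau>(1)])
  qed
  moreover have "{v, map_sum \<sigma> \<tau> v} \<in> edges (disjoint_union A B)"
    if "v \<in> verts (disjoint_union A B)" for v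
  proof (cases v)
    case (Inl x)
    then have "Inl ` {x, \<sigma> x} \<in> edges (disjoint_union A B)"
      using that by (intro edges_disjoint_unionI1 \<sigma>(2)) (simp add: verts_disjoint_union_iff)
    then show ?thesis using Inl by simp
  next
    case (Inr y)
    then have "Inr ` {y, \<tau> y} \<in> edges (disjoint_union A B)"
      using that by (intro edges_disjoint_unionI2 \<tau>(2)) (simp add: verts_disjoint_union_iff)
    then show ?thesis using Inr by simp
  qed
  ultimately show ?thesis unfolding has_cycle_cover_def by blast
qed

lemma edges_copiesI: "i < n \<Longrightarrow> e \<in> edges A \<Longrightarrow> Pair i ` e \<in> edges (copies n A)"
  unfolding copies_def snd_conv by blast

lemma cycle_cover_copies:
  assumes "has_cycle_cover A"
  shows "has_cycle_cover (copies n A)"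
proof -
  obtain \<sigma> where \<sigma>: "inj_on \<sigma> (verts A)" "\<And>v. v \<in> verts A \<Longrightarrow> {v, \<sigma> v} \<in> edges A"
    using assms unfolding has_cycle_cover_def by blast
  have "inj_on (map_prod id \<sigma>) (verts (copies n A))"
    using \<sigma>(1) by (auto simp: inj_on_def copies_def)
  moreover have "{v, map_prod id \<sigma> v} \<in> edges (copies n A)" if "v \<in> verts (copies n A)" for v
  proof (cases v)
    case (Pair i w)
    then have "i < n" "w \<in> verts A" using that by (auto simp: copies_def)
    then show ?thesis using edges_copiesI [OF _ \<sigma>(2), of i n w] Pair by simp
  qed
  ultimately show ?thesis unfolding has_cycle_cover_def by blast
qed

lemmas simple_cycle_cover = simple_complete_graph simple_cycle_graph simple_disjoint_union simple_copies
  cycle_cover_complete_graph cycle_cover_cycle_graph cycle_cover_disjoint_union cycle_cover_copies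

lemma arc_matching_3K3:
  assumes "contains_subgraph (edge_induced R) (copies 3 (complete_graph 3))"
  shows "\<exists>M. arc_matching R M \<and> card M = 9"
proof -
  have "\<exists>M. arc_matching R M \<and> card M = card (verts (copies 3 (complete_graph 3)))"
    by (rule arc_matching_of_contains [OF _ assms]) (simp_all add: simple_cycle_cover)
  then show ?thesis by (simp add: copies_def complete_graph_def)
qed

lemma arc_matching_K3_3K2:
  assumes "contains_subgraph (edge_induced R) (disjoint_union (complete_graph 3) (copies 3 (complete_graph 2)))"
  shows "\<exists>M. arc_matching R M \<and> card M = 9"
proof -
  have "\<exists>M. arc_matching R M \<and> card M = card (verts (disjoint_union (complete_graph 3) (copies 3 (complete_graph 2))))"
    by (rule arc_matching_of_contains [OF _ assms]) (simp_all add: simple_cycle_cover)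
  then show ?thesis by (simp add: disjoint_union_def copies_def complete_graph_def card_Plus)
qed

lemma arc_matching_C7_K2:
  assumes "contains_subgraph (edge_induced R) (disjoint_union (cycle_graph 7) (complete_graph 2))"
  shows "\<exists>M. arc_matching R M \<and> card M = 9"
proof -
  have "\<exists>M. arc_matching R M \<and> card M = card (verts (disjoint_union (cycle_graph 7) (complete_graph 2)))"
    by (rule arc_matching_of_contains [OF _ assms]) (simp_all add: simple_cycle_cover)
  then show ?thesis by (simp add: disjoint_union_def cycle_graph_def complete_graph_def card_Plus)
qed

section \<open>Recognising the target graphs from explicit vertices\<close>

text \<open>The vertices of \<open>edge_induced R\<close> are exactly those met by R; a cycle cover
  rules out isolated vertices of A, so preserving edges already places all images there.\<close>

lemma contains_subgraph_edge_inducedI: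
  assumes "simple_graph A" "has_cycle_cover A" "inj_on \<phi> (verts A)" "\<And>e. e \<in> edges A \<Longrightarrow> \<phi> ` e \<in> R"
  shows "contains_subgraph (edge_induced R) A"
proof -
  have "\<phi> v \<in> \<Union>R" if "v \<in> verts A" for v
  proof -
    obtain e where "e \<in> edges A" "v \<in> e" using has_cycle_cover_verts [OF assms(2)] \<open>v \<in> verts A\<close> by blast
    then show ?thesis using assms(4) by blast
  qed
  then show ?thesis
    unfolding contains_subgraph_iff [OF assms(1)] edge_induced_def fst_conv snd_conv
    using assms(3,4) by (intro exI [of _ \<phi>] conjI ballI image_subsetI)
qed

lemma contains_3K3:
  assumes d: "distinct [a0, a1, a2, b0, b1, b2, c0, c1, c2]"
    and R: "{a0, a1} \<in> R" "{a1, a2} \<in> R" "{a2, a0} \<in> R" "{b0, b1} \<in> R" "{b1, b2} \<in> R" "{b2, b0} \<in> R"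
      "{c0, c1} \<in> R" "{c1, c2} \<in> R" "{c2, c0} \<in> R"
  shows "contains_subgraph (edge_induced R) (copies 3 (complete_graph 3))"
proof -
  \<comment> \<open>\<open>?idx\<close> numbers the model vertices consecutively, so that
    injectivity of the embedding reduces to distinctness of the list.\<close>
  let ?L = "[a0, a1, a2, b0, b1, b2, c0, c1, c2]" and ?idx = "\<lambda>(i, j). 3 * i + j :: nat"
  let ?A = "copies 3 (complete_graph 3)"
  have lt3: "i < 3 \<longleftrightarrow> i = 0 \<or> i = 1 \<or> i = 2" for i :: nat by auto
  have R': "{a1, a0} \<in> R" "{a2, a1} \<in> R" "{a0, a2} \<in> R" "{b1, b0} \<in> R" "{b2, b1} \<in> R" "{b0, b2} \<in> R"
      "{c1, c0} \<in> R" "{c2, c1} \<in> R" "{c0, c2} \<in> R"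
    using R by (simp_all add: insert_commute)
  show ?thesis
  proof (rule contains_subgraph_edge_inducedI [of _ "\<lambda>v. ?L ! ?idx v"])
    show "simple_graph ?A" "has_cycle_cover ?A"
      by (simp_all add: simple_cycle_cover)
    have "inj_on ?idx (verts ?A)" "?idx ` verts ?A \<subseteq> {..<length ?L}"
      by (auto simp: inj_on_def copies_def complete_graph_def lt3)
    then show "inj_on (\<lambda>v. ?L ! ?idx v) (verts ?A)"
      using comp_inj_on [OF _ inj_on_nth [OF d]] by (auto simp: o_def image_subset_iff)
    fix e assume "e \<in> edges ?A"
    then obtain i j k where "e = {(i, j), (i, k)}" "i < 3" "j < 3" "k < 3" "j \<noteq> k"
      by (auto simp: copies_def complete_graph_def)
    then show "(\<lambda>v. ?L ! ?idx v) ` e \<in> R"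
      using R R' unfolding lt3 by (elim disjE) simp_all
  qed
qed

lemma contains_K3_3K2:
  assumes d: "distinct [a0, a1, a2, x0, y0, x1, y1, x2, y2]"
    and R: "{a0, a1} \<in> R" "{a1, a2} \<in> R" "{a2, a0} \<in> R" "{x0, y0} \<in> R" "{x1, y1} \<in> R" "{x2, y2} \<in> R"
  shows "contains_subgraph (edge_induced R) (disjoint_union (complete_graph 3) (copies 3 (complete_graph 2)))"
proof -
  let ?L = "[a0, a1, a2, x0, y0, x1, y1, x2, y2]"
  let ?idx = "case_sum (\<lambda>j. j) (\<lambda>(i, j). 3 + 2 * i + j :: nat)"
  let ?A = "disjoint_union (complete_graph 3) (copies 3 (complete_graph 2))"
  have lt3: "i < 3 \<longleftrightarrow> i = 0 \<or> i = 1 \<or> i = 2" for i :: nat by auto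
  have lt2: "i < 2 \<longleftrightarrow> i = 0 \<or> i = 1" for i :: nat by auto
  have R': "{a1, a0} \<in> R" "{a2, a1} \<in> R" "{a0, a2} \<in> R" "{y0, x0} \<in> R" "{y1, x1} \<in> R" "{y2, x2} \<in> R"
    using R by (simp_all add: insert_commute)
  show ?thesis
  proof (rule contains_subgraph_edge_inducedI [of _ "\<lambda>v. ?L ! ?idx v"])
    show "simple_graph ?A" "has_cycle_cover ?A"
      by (simp_all add: simple_cycle_cover)
    have "inj_on ?idx (verts ?A)" "?idx ` verts ?A \<subseteq> {..<length ?L}"
      by (auto simp: inj_on_def disjoint_union_def copies_def complete_graph_def lt3 lt2)
    then show "inj_on (\<lambda>v. ?L ! ?idx v) (verts ?A)"
      using comp_inj_on [OF _ inj_on_nth [OF d]] by (auto simp: o_def image_subset_iff)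
    fix e assume "e \<in> edges ?A"
    then consider j k where "e = {Inl j, Inl k}" "j < 3" "k < 3" "j \<noteq> k"
      | i j k where "e = {Inr (i, j), Inr (i, k)}" "i < 3" "j < 2" "k < 2" "j \<noteq> k"
      by (auto simp: disjoint_union_def copies_def complete_graph_def)
    then show "(\<lambda>v. ?L ! ?idx v) ` e \<in> R"
    proof cases
      case 1
      then show ?thesis using R R' unfolding lt3 by (elim disjE) simp_all
    next
      case 2
      then show ?thesis using R R' unfolding lt3 lt2 by (elim disjE) simp_all
    qed
  qed
qed

lemma contains_C7_K2:
  assumes d: "distinct [v0, v1, v2, v3, v4, v5, v6, x, y]"
    and R: "{v0, v1} \<in> R" "{v1, v2} \<in> R" "{v2, v3} \<in> R" "{v3, v4} \<in> R" "{v4, v5} \<in> R"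
      "{v5, v6} \<in> R" "{v6, v0} \<in> R" "{x, y} \<in> R"
  shows "contains_subgraph (edge_induced R) (disjoint_union (cycle_graph 7) (complete_graph 2))"
proof -
  let ?L = "[v0, v1, v2, v3, v4, v5, v6, x, y]"
  let ?idx = "case_sum (\<lambda>j. j) (\<lambda>j. 7 + j :: nat)"
  let ?A = "disjoint_union (cycle_graph 7) (complete_graph 2)"
  have lt7: "i < 7 \<longleftrightarrow> i = 0 \<or> i = 1 \<or> i = 2 \<or> i = 3 \<or> i = 4 \<or> i = 5 \<or> i = 6" for i :: nat by auto
  have lt2: "i < 2 \<longleftrightarrow> i = 0 \<or> i = 1" for i :: nat by auto
  have R': "{y, x} \<in> R" using R by (simp add: insert_commute)
  show ?thesis
  proof (rule contains_subgraph_edge_inducedI [of _ "\<lambda>v. ?L ! ?idx v"])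
    show "simple_graph ?A" "has_cycle_cover ?A"
      by (simp_all add: simple_cycle_cover)
    have "inj_on ?idx (verts ?A)" "?idx ` verts ?A \<subseteq> {..<length ?L}"
      by (auto simp: inj_on_def disjoint_union_def cycle_graph_def complete_graph_def lt2)
    then show "inj_on (\<lambda>v. ?L ! ?idx v) (verts ?A)"
      using comp_inj_on [OF _ inj_on_nth [OF d]] by (auto simp: o_def image_subset_iff)
    fix e assume "e \<in> edges ?A"
    then consider j where "e = {Inl j, Inl (Suc j mod 7)}" "j < 7"
      | j k where "e = {Inr j, Inr k}" "j < 2" "k < 2" "j \<noteq> k"
      by (auto simp: disjoint_union_def cycle_graph_def complete_graph_def)
    then show "(\<lambda>v. ?L ! ?idx v) ` e \<in> R"
    proof cases
      case 1
      then show ?thesis using R unfolding lt7 by (elim disjE) simp_all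
    next
      case 2
      then show ?thesis using R R' unfolding lt2 by (elim disjE) simp_all
    qed
  qed
qed

section \<open>Excluded configurations\<close>

locale planar_neighbouring =
  fixes G :: "'a graph" and R :: "'a set set"
  assumes simple: "simple_graph G" and planar: "planar G" and neighbouring: "neighbouring G R"
begin

definition adj :: "'a \<Rightarrow> 'a \<Rightarrow> bool" where
  "adj x y \<longleftrightarrow> {x, y} \<in> edges G"

lemma adj_sym: "adj x y \<longleftrightarrow> adj y x"
  by (simp add: adj_def insert_commute)

lemma adj_verts: "adj x y \<Longrightarrow> x \<in> verts G \<and> y \<in> verts G \<and> x \<noteq> y"
proof -
  assume "adj x y"
  then have "{x, y} \<subseteq> verts G" "card {x, y} = 2"
    using simple unfolding adj_def simple_graph_def by blast+
  then show ?thesis by (cases "x = y") simp_all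
qed

lemma R_adj: "{x, y} \<in> R \<Longrightarrow> adj x y"
  using neighbouring unfolding adj_def neighbouring_def by blast

lemma touches_adj: "touches G A B \<longleftrightarrow> (\<exists>x\<in>A. \<exists>y\<in>B. adj x y)"
  by (simp add: touches_def adj_def)

lemma R_touches: "e \<in> R \<Longrightarrow> f \<in> R \<Longrightarrow> e \<inter> f = {} \<Longrightarrow> touches G e f"
proof -
  assume e: "e \<in> R" "f \<in> R" "e \<inter> f = {}"
  then obtain u v where "u \<in> e" "v \<in> f" "u = v \<or> {u, v} \<in> edges G"
    using neighbouring unfolding neighbouring_def by blast
  moreover from this have "u \<noteq> v" using e(3) by auto
  ultimately show ?thesis unfolding touches_def by blast
qed

lemma R_touches_pairs:
  assumes "{a, b} \<in> R" "{c, d} \<in> R" "{a, b} \<inter> {c, d} = {}"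
  shows "adj a c \<or> adj a d \<or> adj b c \<or> adj b d"
  using R_touches [OF assms] unfolding touches_adj by blast

lemma linked_pair: "adj x y \<Longrightarrow> linked G {x, y}"
proof -
  assume xy: "adj x y"
  then have "touches G {x} {y}" by (simp add: touches_adj)
  then have "linked G ({x} \<union> {y})"
    using adj_verts [OF xy] by (intro linked_Un linked_singleton) simp_all
  then show ?thesis by (simp add: insert_commute)
qed

lemma R_linked: 
  assumes "e \<in> R" shows "linked G e"
proof -
  have "e \<in> edges G" using neighbouring assms unfolding neighbouring_def by blast
  then have "card e = 2" using simple unfolding simple_graph_def by blast
  then obtain x y where e: "e = {x, y}" unfolding card_2_iff by blast
  then show ?thesis using R_adj [of x y] assms linked_pair [of x y] by simp
qed

section \<open>K5 minors built from disjoint edges of the neighbouring set\<close>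

lemma no_five_disjoint_edges:
  assumes "P \<subseteq> R" "disjoint P" "card P = 5"
  shows False
proof -
  have "finite P" using assms(3) card.infinite by fastforce
  then obtain h where h: "bij_betw h {0..<5::nat} P"
    using ex_bij_betw_nat_finite assms(3) by metis
  show False
  proof (rule planar_no_K5_minor [OF planar])
    show "linked G (h a)" if "a < 5" for a
    proof (rule R_linked)
      have "h a \<in> P" using bij_betwE [OF h] that by simp
      then show "h a \<in> R" using assms(1) by blast
    qed
    fix a b :: nat assume ab: "a < b" "b < 5"
    then have "h a \<in> P" "h b \<in> P" "h a \<noteq> h b"
      using bij_betwE [OF h] inj_on_eq_iff [OF bij_betw_imp_inj_on [OF h], of a b] by simp_all
    moreover from this have "h a \<inter> h b = {}" using assms(2) by (simp add: disjointD)
    ultimately show "h a \<inter> h b = {} \<and> touches G (h a) (h b)"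
      using R_touches assms(1) by blast
  qed
qed

lemma no_K5_sets:
  assumes "linked G A" "linked G B" "linked G C" "linked G D" "linked G E"
    and "A \<inter> B = {}" "A \<inter> C = {}" "A \<inter> D = {}" "A \<inter> E = {}" "B \<inter> C = {}" "B \<inter> D = {}"
      "B \<inter> E = {}" "C \<inter> D = {}" "C \<inter> E = {}" "D \<inter> E = {}"
    and "touches G A B" "touches G A C" "touches G A D" "touches G A E" "touches G B C"
      "touches G B D" "touches G B E" "touches G C D" "touches G C E" "touches G D E"
  shows False
proof (rule planar_no_K5_minor [OF planar, of "\<lambda>i. [A, B, C, D, E] ! i"])
  have lt5: "a < 5 \<longleftrightarrow> a = 0 \<or> a = 1 \<or> a = 2 \<or> a = 3 \<or> a = 4" for a :: nat by auto
  show "linked G ([A, B, C, D, E] ! a)" if "a < 5" for a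
    using that assms unfolding lt5 by auto
  show "[A, B, C, D, E] ! a \<inter> [A, B, C, D, E] ! b = {} \<and>
      touches G ([A, B, C, D, E] ! a) ([A, B, C, D, E] ! b)" if "a < b" "b < 5" for a b
    using that assms unfolding lt5 by (elim disjE; simp add: less_Suc_eq numeral_eq_Suc; elim disjE; simp)
qed

text \<open>Disjoint edges of R touch pairwise since R is neighbouring, so only the four adjacencies
  of x have to be supplied.\<close>

lemma no_vertex_four_edges:
  assumes "x \<in> verts G" "e1 \<in> R" "e2 \<in> R" "e3 \<in> R" "e4 \<in> R"
    and "x \<notin> e1" "x \<notin> e2" "x \<notin> e3" "x \<notin> e4"
    and "e1 \<inter> e2 = {}" "e1 \<inter> e3 = {}" "e1 \<inter> e4 = {}" "e2 \<inter> e3 = {}" "e2 \<inter> e4 = {}" "e3 \<inter> e4 = {}"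
    and "touches G {x} e1" "touches G {x} e2" "touches G {x} e3" "touches G {x} e4"
  shows False
  by (rule no_K5_sets [of "{x}" e1 e2 e3 e4]) (use assms R_linked R_touches linked_singleton [OF assms(1)] in simp_all)

text \<open>Any two vertices of a five-cycle lie in different edges of the perfect matching left by
  deleting a suitable third vertex. Two neighbours of x would thus provide two more edges touched by
  x besides e and f.\<close>

lemma at_most_one_neighbour_in_C5:
  assumes x: "x \<in> verts G" and ef: "e \<in> R" "f \<in> R" "e \<inter> f = {}" "x \<notin> e \<union> f"
    and tch: "touches G {x} e" "touches G {x} f"
    and d: "distinct [v0, v1, v2, v3, v4]" "{v0, v1, v2, v3, v4} \<inter> insert x (e \<union> f) = {}"
    and C: "{v0, v1} \<in> R" "{v1, v2} \<in> R" "{v2, v3} \<in> R" "{v3, v4} \<in> R" "{v4, v0} \<in> R"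
  shows "\<exists>k. \<forall>v\<in>{v0, v1, v2, v3, v4}. adj x v \<longrightarrow> v = k"
proof -
  have two: "\<not> ((adj x p \<or> adj x q) \<and> (adj x r \<or> adj x s))"
    if "{p, q} \<in> R" "{r, s} \<in> R" "distinct [p, q, r, s]" "{p, q, r, s} \<subseteq> {v0, v1, v2, v3, v4}" for p q r s
  proof
    assume "(adj x p \<or> adj x q) \<and> (adj x r \<or> adj x s)"
    then have "touches G {x} {p, q}" "touches G {x} {r, s}" by (auto simp: touches_adj)
    moreover have "x \<notin> {p, q}" "x \<notin> {r, s}" "e \<inter> {p, q} = {}" "e \<inter> {r, s} = {}"
      "f \<inter> {p, q} = {}" "f \<inter> {r, s} = {}"
      using that(4) d(2) by blast+
    moreover have "{p, q} \<inter> {r, s} = {}" using that(3) by auto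
    ultimately show False
      using no_vertex_four_edges [of x e f "{p, q}" "{r, s}"] x ef tch that(1,2) by blast
  qed
  have "\<not> ((adj x v1 \<or> adj x v2) \<and> (adj x v3 \<or> adj x v4))"
    "\<not> ((adj x v2 \<or> adj x v3) \<and> (adj x v4 \<or> adj x v0))"
    "\<not> ((adj x v3 \<or> adj x v4) \<and> (adj x v0 \<or> adj x v1))"
    "\<not> ((adj x v4 \<or> adj x v0) \<and> (adj x v1 \<or> adj x v2))"
    "\<not> ((adj x v0 \<or> adj x v1) \<and> (adj x v2 \<or> adj x v3))"
    by (rule two; use d C in auto)+
  then show ?thesis by auto
qed

lemma C5_not_covered_by_two:
  assumes "distinct [v0, v1, v2, v3, v4]"
    and "v0 \<in> {k, l} \<or> v1 \<in> {k, l}" "v1 \<in> {k, l} \<or> v2 \<in> {k, l}" "v2 \<in> {k, l} \<or> v3 \<in> {k, l}"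
      "v3 \<in> {k, l} \<or> v4 \<in> {k, l}" "v4 \<in> {k, l} \<or> v0 \<in> {k, l}"
  shows False
  using assms by auto

text \<open>The edge \<open>xy\<close> touches every edge of the cycle, so the neighbours k and l
  would cover a five-cycle, which takes three vertices.\<close>

lemma no_edge_and_C5:
  assumes d: "distinct [v0, v1, v2, v3, v4]" "{x, y} \<inter> {v0, v1, v2, v3, v4} = {}"
    and C: "{v0, v1} \<in> R" "{v1, v2} \<in> R" "{v2, v3} \<in> R" "{v3, v4} \<in> R" "{v4, v0} \<in> R"
    and xy: "{x, y} \<in> R"
    and k: "\<exists>k. \<forall>v\<in>{v0, v1, v2, v3, v4}. adj x v \<longrightarrow> v = k"
    and l: "\<exists>l. \<forall>v\<in>{v0, v1, v2, v3, v4}. adj y v \<longrightarrow> v = l"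
  shows False
proof -
  from k obtain k where k: "\<forall>v\<in>{v0, v1, v2, v3, v4}. adj x v \<longrightarrow> v = k" ..
  from l obtain l where l: "\<forall>v\<in>{v0, v1, v2, v3, v4}. adj y v \<longrightarrow> v = l" ..
  have "p \<in> {k, l} \<or> q \<in> {k, l}" if "{p, q} \<in> R" "{p, q} \<subseteq> {v0, v1, v2, v3, v4}" for p q
  proof -
    have "{x, y} \<inter> {p, q} = {}" using that(2) d(2) by auto
    from R_touches_pairs [OF xy that(1) this] show ?thesis
      using bspec [OF k, of p] bspec [OF k, of q] bspec [OF l, of p] bspec [OF l, of q] that(2)
      by auto
  qed
  then show False by (intro C5_not_covered_by_two [OF d(1), of k l]; use C in simp)
qed

text \<open>On the first cycle a vertex touches the two disjoint edges that remain after its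
  deletion. So each end of \<open>{u0, u1}\<close> has at most one neighbour on the second
  cycle.\<close>

lemma no_C5_C5:
  assumes d: "distinct [u0, u1, u2, u3, u4, v0, v1, v2, v3, v4]"
    and U: "{u0, u1} \<in> R" "{u1, u2} \<in> R" "{u2, u3} \<in> R" "{u3, u4} \<in> R" "{u4, u0} \<in> R"
    and V: "{v0, v1} \<in> R" "{v1, v2} \<in> R" "{v2, v3} \<in> R" "{v3, v4} \<in> R" "{v4, v0} \<in> R"
  shows False
proof (rule no_edge_and_C5 [OF _ _ V U(1)])
  have adj: "adj u0 u1" "adj u1 u2" "adj u4 u0" "adj u1 u0" "adj u0 u4"
    using U R_adj adj_sym by blast+
  note verts = adj_verts [OF adj(1)]
  show "\<exists>k. \<forall>v\<in>{v0, v1, v2, v3, v4}. adj u0 v \<longrightarrow> v = k"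
    by (rule at_most_one_neighbour_in_C5 [OF _ U(2) U(4) _ _ _ _ _ _ V])
      (use d adj verts in \<open>auto simp: touches_adj\<close>)
  show "\<exists>k. \<forall>v\<in>{v0, v1, v2, v3, v4}. adj u1 v \<longrightarrow> v = k"
    by (rule at_most_one_neighbour_in_C5 [OF _ U(3) U(5) _ _ _ _ _ _ V])
      (use d adj verts in \<open>auto simp: touches_adj\<close>)
qed (use d in auto)

text \<open>The edge \<open>{g, h}\<close> touches every side of the triangle, so at least two
  corners touch it. Each of these also touches its opposite side, hence has at most one neighbour on
  the five-cycle, and the side joining the two is impossible.\<close>

lemma no_K3_C5_K2:
  assumes d: "distinct [a, b, c, g, h, v0, v1, v2, v3, v4]"
    and T: "{a, b} \<in> R" "{b, c} \<in> R" "{c, a} \<in> R" and e: "{g, h} \<in> R"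
    and V: "{v0, v1} \<in> R" "{v1, v2} \<in> R" "{v2, v3} \<in> R" "{v3, v4} \<in> R" "{v4, v0} \<in> R"
  shows False
proof -
  have two: False if "touches G {x} {g, h}" "touches G {y} {g, h}" "distinct [x, y, z]"
    "{x, y, z} \<subseteq> {a, b, c}" "{x, y} \<in> R" "{y, z} \<in> R" "{z, x} \<in> R" for x y z
  proof (rule no_edge_and_C5 [OF _ _ V that(5)])
    have adj: "adj x y" "adj y x" "adj x z" "adj y z" using that R_adj adj_sym by blast+
    note verts = adj_verts [OF adj(1)]
    have d': "distinct [x, y, z, g, h, v0, v1, v2, v3, v4]" using that d by auto
    show "\<exists>k. \<forall>v\<in>{v0, v1, v2, v3, v4}. adj x v \<longrightarrow> v = k"
      by (rule at_most_one_neighbour_in_C5 [OF _ e that(6) _ _ that(1) _ _ _ V])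
        (use d' adj verts in \<open>auto simp: touches_adj\<close>)
    show "\<exists>k. \<forall>v\<in>{v0, v1, v2, v3, v4}. adj y v \<longrightarrow> v = k"
      by (rule at_most_one_neighbour_in_C5 [OF _ e that(7) _ _ that(2) _ _ _ V])
        (use d' adj verts in \<open>auto simp: touches_adj\<close>)
    show "distinct [v0, v1, v2, v3, v4]" "{x, y} \<inter> {v0, v1, v2, v3, v4} = {}" using d' by auto
  qed
  have tch: "touches G {x} {g, h} \<or> touches G {y} {g, h}" if "{x, y} \<in> R" "{x, y} \<subseteq> {a, b, c}" for x y
  proof -
    have "{x, y} \<inter> {g, h} = {}" using that(2) d by auto
    then show ?thesis using R_touches_pairs [OF that(1) e] by (auto simp: touches_adj)
  qed
  have "\<not> (touches G {a} {g, h} \<and> touches G {b} {g, h})" using two [of a b c] d T by auto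
  moreover have "\<not> (touches G {b} {g, h} \<and> touches G {c} {g, h})" using two [of b c a] d T by auto
  moreover have "\<not> (touches G {c} {g, h} \<and> touches G {a} {g, h})" using two [of c a b] d T by auto
  moreover note tch [OF T(1)] tch [OF T(2)] tch [OF T(3)]
  ultimately show False by blast
qed

text \<open>The cycle vertices touching a given outside edge cover the five-cycle, so there are at
  least three. Since 3 + 3 > 5, some vertex touches both outside edges; it also touches the two
  edges of the cycle that avoid it.\<close>

lemma no_C5_2K2:
  assumes d: "distinct [g, h, g', h', v0, v1, v2, v3, v4]"
    and e: "{g, h} \<in> R" "{g', h'} \<in> R"
    and V: "{v0, v1} \<in> R" "{v1, v2} \<in> R" "{v2, v3} \<in> R" "{v3, v4} \<in> R" "{v4, v0} \<in> R"
  shows False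
proof -
  have adj: "adj v0 v1" "adj v1 v2" "adj v2 v3" "adj v3 v4" "adj v4 v0"
    using V R_adj by blast+
  have adj': "adj v1 v0" "adj v2 v1" "adj v3 v2" "adj v4 v3" "adj v0 v4"
    using adj adj_sym by blast+
  have common: "\<not> (touches G {x} {g, h} \<and> touches G {x} {g', h'})"
    if "{x, p, q, r, s} = {v0, v1, v2, v3, v4}" "distinct [x, p, q, r, s]" "{p, q} \<in> R" "{r, s} \<in> R"
      "adj x p" "adj x s" for x p q r s
  proof
    assume "touches G {x} {g, h} \<and> touches G {x} {g', h'}"
    moreover have "{x, p, q, r, s} \<inter> {g, h, g', h'} = {}" unfolding that(1) using d by auto
    moreover have "{g, h} \<inter> {g', h'} = {}" using d by auto
    moreover have "touches G {x} {p, q}" "touches G {x} {r, s}" using that by (auto simp: touches_adj)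
    ultimately show False
      using that(2) adj_verts [OF that(5)] no_vertex_four_edges [OF _ e that(3,4), of x] by auto
  qed
  have tch: "touches G {x} {g, h} \<or> touches G {y} {g, h}" "touches G {x} {g', h'} \<or> touches G {y} {g', h'}"
    if "{x, y} \<in> R" "{x, y} \<subseteq> {v0, v1, v2, v3, v4}" for x y
  proof -
    have "{x, y} \<inter> {g, h} = {}" "{x, y} \<inter> {g', h'} = {}" using that(2) d by auto
    then show "touches G {x} {g, h} \<or> touches G {y} {g, h}" "touches G {x} {g', h'} \<or> touches G {y} {g', h'}"
      using R_touches_pairs [OF that(1) e(1)] R_touches_pairs [OF that(1) e(2)]
      by (auto simp: touches_adj)
  qed
  note tch [OF V(1)] tch [OF V(2)] tch [OF V(3)] tch [OF V(4)] tch [OF V(5)]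
  moreover have "\<not> (touches G {v0} {g, h} \<and> touches G {v0} {g', h'})"
    by (rule common [of v0 v1 v2 v3 v4]) (use d V adj adj' in auto)
  moreover have "\<not> (touches G {v1} {g, h} \<and> touches G {v1} {g', h'})"
    by (rule common [of v1 v2 v3 v4 v0]) (use d V adj adj' in auto)
  moreover have "\<not> (touches G {v2} {g, h} \<and> touches G {v2} {g', h'})"
    by (rule common [of v2 v3 v4 v0 v1]) (use d V adj adj' in auto)
  moreover have "\<not> (touches G {v3} {g, h} \<and> touches G {v3} {g', h'})"
    by (rule common [of v3 v4 v0 v1 v2]) (use d V adj adj' in auto)
  moreover have "\<not> (touches G {v4} {g, h} \<and> touches G {v4} {g', h'})"
    by (rule common [of v4 v0 v1 v2 v3]) (use d V adj adj' in auto)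
  ultimately show False by simp (metis)
qed

text \<open>A corner x touches the opposite side of the triangle, so for each deleted cycle vertex
  it misses one of the three remaining matching edges (\<open>local\<close>). The neighbours of two
  corners together meet every cycle edge (\<open>covers\<close>). For the 21 possible adjacencies
  these demands contradict each other.\<close>

lemma no_K3_C7:
  assumes d: "distinct [a, b, c, v0, v1, v2, v3, v4, v5, v6]"
    and T: "{a, b} \<in> R" "{b, c} \<in> R" "{c, a} \<in> R"
    and V: "{v0, v1} \<in> R" "{v1, v2} \<in> R" "{v2, v3} \<in> R" "{v3, v4} \<in> R" "{v4, v5} \<in> R"
      "{v5, v6} \<in> R" "{v6, v0} \<in> R"
  shows False
proof -
  have three: "\<not> ((adj x p \<or> adj x q) \<and> (adj x r \<or> adj x s) \<and> (adj x t \<or> adj x u))"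
    if "distinct [x, y, z, p, q, r, s, t, u]" "{x, y} \<in> R" "{y, z} \<in> R"
      "{p, q} \<in> R" "{r, s} \<in> R" "{t, u} \<in> R" for x y z p q r s t u
  proof
    assume "(adj x p \<or> adj x q) \<and> (adj x r \<or> adj x s) \<and> (adj x t \<or> adj x u)"
    moreover have "adj x y" using R_adj that by blast
    ultimately have "touches G {x} {y, z}" "touches G {x} {p, q}" "touches G {x} {r, s}"
      "touches G {x} {t, u}" "x \<in> verts G"
      using adj_verts [of x y] by (simp_all add: touches_adj)
    then show False
      using no_vertex_four_edges [OF _ that(3-6), of x] that(1) by auto
  qed
  have local: "\<not> ((adj x v1 \<or> adj x v2) \<and> (adj x v3 \<or> adj x v4) \<and> (adj x v5 \<or> adj x v6))"
    "\<not> ((adj x v2 \<or> adj x v3) \<and> (adj x v4 \<or> adj x v5) \<and> (adj x v6 \<or> adj x v0))"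
    "\<not> ((adj x v3 \<or> adj x v4) \<and> (adj x v5 \<or> adj x v6) \<and> (adj x v0 \<or> adj x v1))"
    "\<not> ((adj x v4 \<or> adj x v5) \<and> (adj x v6 \<or> adj x v0) \<and> (adj x v1 \<or> adj x v2))"
    "\<not> ((adj x v5 \<or> adj x v6) \<and> (adj x v0 \<or> adj x v1) \<and> (adj x v2 \<or> adj x v3))"
    "\<not> ((adj x v6 \<or> adj x v0) \<and> (adj x v1 \<or> adj x v2) \<and> (adj x v3 \<or> adj x v4))"
    "\<not> ((adj x v0 \<or> adj x v1) \<and> (adj x v2 \<or> adj x v3) \<and> (adj x v4 \<or> adj x v5))"
    if "distinct [x, y, z]" "{x, y, z} = {a, b, c}" "{x, y} \<in> R" "{y, z} \<in> R" for x y z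
  proof -
    have "{x, y, z} \<inter> {v0, v1, v2, v3, v4, v5, v6} = {}" unfolding that(2) using d by auto
    then have d': "distinct [x, y, z, v0, v1, v2, v3, v4, v5, v6]" using d that(1) by auto
    note three = three [OF _ that(3,4)]
    show "\<not> ((adj x v1 \<or> adj x v2) \<and> (adj x v3 \<or> adj x v4) \<and> (adj x v5 \<or> adj x v6))"
      by (rule three [OF _ V(2) V(4) V(6)]) (use d' in auto)
    show "\<not> ((adj x v2 \<or> adj x v3) \<and> (adj x v4 \<or> adj x v5) \<and> (adj x v6 \<or> adj x v0))"
      by (rule three [OF _ V(3) V(5) V(7)]) (use d' in auto)
    show "\<not> ((adj x v3 \<or> adj x v4) \<and> (adj x v5 \<or> adj x v6) \<and> (adj x v0 \<or> adj x v1))"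
      by (rule three [OF _ V(4) V(6) V(1)]) (use d' in auto)
    show "\<not> ((adj x v4 \<or> adj x v5) \<and> (adj x v6 \<or> adj x v0) \<and> (adj x v1 \<or> adj x v2))"
      by (rule three [OF _ V(5) V(7) V(2)]) (use d' in auto)
    show "\<not> ((adj x v5 \<or> adj x v6) \<and> (adj x v0 \<or> adj x v1) \<and> (adj x v2 \<or> adj x v3))"
      by (rule three [OF _ V(6) V(1) V(3)]) (use d' in auto)
    show "\<not> ((adj x v6 \<or> adj x v0) \<and> (adj x v1 \<or> adj x v2) \<and> (adj x v3 \<or> adj x v4))"
      by (rule three [OF _ V(7) V(2) V(4)]) (use d' in auto)
    show "\<not> ((adj x v0 \<or> adj x v1) \<and> (adj x v2 \<or> adj x v3) \<and> (adj x v4 \<or> adj x v5))"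
      by (rule three [OF _ V(1) V(3) V(5)]) (use d' in auto)
  qed
  have covers: "(adj x v0 \<or> adj x v1 \<or> adj y v0 \<or> adj y v1) \<and> (adj x v1 \<or> adj x v2 \<or> adj y v1 \<or> adj y v2) \<and>
    (adj x v2 \<or> adj x v3 \<or> adj y v2 \<or> adj y v3) \<and> (adj x v3 \<or> adj x v4 \<or> adj y v3 \<or> adj y v4) \<and>
    (adj x v4 \<or> adj x v5 \<or> adj y v4 \<or> adj y v5) \<and> (adj x v5 \<or> adj x v6 \<or> adj y v5 \<or> adj y v6) \<and>
    (adj x v6 \<or> adj x v0 \<or> adj y v6 \<or> adj y v0)"
    if "{x, y} \<in> R" "{x, y} \<subseteq> {a, b, c}" for x y
  proof -
    have "{x, y} \<inter> {v0, v1, v2, v3, v4, v5, v6} = {}" using that(2) d by auto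
    then show ?thesis
      using R_touches_pairs [OF that(1) V(1)] R_touches_pairs [OF that(1) V(2)]
        R_touches_pairs [OF that(1) V(3)] R_touches_pairs [OF that(1) V(4)]
        R_touches_pairs [OF that(1) V(5)] R_touches_pairs [OF that(1) V(6)]
        R_touches_pairs [OF that(1) V(7)] by simp
  qed
  have "{a, b, c} = {b, c, a}" "{a, b, c} = {c, a, b}" by auto
  then have A: "distinct [a, b, c]" "{a, b, c} = {a, b, c}" and B: "distinct [b, c, a]" "{b, c, a} = {a, b, c}"
    and C: "distinct [c, a, b]" "{c, a, b} = {a, b, c}"
    using d by auto
  have sub: "{a, b} \<subseteq> {a, b, c}" "{b, c} \<subseteq> {a, b, c}" "{c, a} \<subseteq> {a, b, c}" by auto
  note local [OF A T(1,2)] local [OF B T(2,3)] local [OF C T(3,1)]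
    covers [OF T(1) sub(1)] covers [OF T(2) sub(2)] covers [OF T(3) sub(3)]
  then show False by sat
qed

text \<open>A vertex with four edges is not flexible enough here, so one branch set has three
  vertices. One triangle is split into a corner and its opposite side, likewise the other, and the
  corner w of the second is merged with an outside edge that it touches.\<close>

lemma no_2K3_2K2:
  assumes d: "distinct [a, b, c, a', b', c', g1, g2, h1, h2]"
    and T: "{a, b} \<in> R" "{b, c} \<in> R" "{c, a} \<in> R"
    and T': "{a', b'} \<in> R" "{b', c'} \<in> R" "{c', a'} \<in> R"
    and e: "{g1, g2} \<in> R" "{h1, h2} \<in> R"
  shows False
proof -
  define U where "U x \<longleftrightarrow> adj x g1 \<or> adj x g2" for x
  define V where "V x \<longleftrightarrow> adj x h1 \<or> adj x h2" for x
  have K5: "\<not> ((adj x e1 \<or> adj x e2) \<and> (adj w f1 \<or> adj w f2) \<and> (adj x u \<or> adj x v) \<and>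
      (adj x w \<or> adj x f1 \<or> adj x f2))"
    if d: "distinct [x, y, z, u, v, w, e1, e2, f1, f2]"
      and T: "{x, y} \<in> R" "{y, z} \<in> R" and T': "{u, v} \<in> R" "{v, w} \<in> R"
      and e: "{e1, e2} \<in> R" "{f1, f2} \<in> R" for x y z u v w e1 e2 f1 f2
  proof
    assume asm: "(adj x e1 \<or> adj x e2) \<and> (adj w f1 \<or> adj w f2) \<and> (adj x u \<or> adj x v) \<and>
      (adj x w \<or> adj x f1 \<or> adj x f2)"
    have adj: "adj x y" "adj v w" using T T' R_adj by blast+
    have verts: "x \<in> verts G" "w \<in> verts G" using adj_verts adj by blast+
    have R: "touches G {e1, e2} {u, v}" "touches G {e1, e2} {y, z}" "touches G {e1, e2} {f1, f2}"
      "touches G {u, v} {y, z}" "touches G {y, z} {f1, f2}"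
      by (rule R_touches; use d T T' e in auto)+
    have "touches G {w} {f1, f2}" using asm by (auto simp: touches_adj)
    then have "linked G ({w} \<union> {f1, f2})"
      using linked_singleton [OF verts(2)] R_linked [OF e(2)] by (intro linked_Un)
    then have "linked G {w, f1, f2}" by (simp add: insert_commute)
    moreover have "touches G {x} {e1, e2}" "touches G {x} {u, v}" "touches G {x} {y, z}"
      "touches G {x} {w, f1, f2}" "touches G {u, v} {w, f1, f2}"
      using asm adj by (auto simp: touches_adj)
    moreover have "touches G {e1, e2} {w, f1, f2}" "touches G {y, z} {w, f1, f2}"
      using R(3,5) by (auto simp: touches_adj)
    ultimately show False
      using no_K5_sets [OF linked_singleton [OF verts(1)] R_linked [OF e(1)] R_linked [OF T'(1)]
        R_linked [OF T(2)], of "{w, f1, f2}"] R d by auto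
  qed
  have W: "(U x \<or> U y) \<and> (V x \<or> V y)" if "{x, y} \<in> R" "{x, y} \<inter> {g1, g2, h1, h2} = {}" for x y
    using R_touches_pairs [OF that(1) e(1)] R_touches_pairs [OF that(1) e(2)] that(2)
    unfolding U_def V_def by auto
  have cross: "adj a a' \<or> adj a b' \<or> adj b a' \<or> adj b b'" "adj a b' \<or> adj a c' \<or> adj b b' \<or> adj b c'"
    "adj a c' \<or> adj a a' \<or> adj b c' \<or> adj b a'" "adj b a' \<or> adj b b' \<or> adj c a' \<or> adj c b'"
    "adj b b' \<or> adj b c' \<or> adj c b' \<or> adj c c'" "adj b c' \<or> adj b a' \<or> adj c c' \<or> adj c a'"
    "adj c a' \<or> adj c b' \<or> adj a a' \<or> adj a b'" "adj c b' \<or> adj c c' \<or> adj a b' \<or> adj a c'"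
    "adj c c' \<or> adj c a' \<or> adj a c' \<or> adj a a'"
    by (rule R_touches_pairs; use d T T' in auto)+
  have edge: "(U a \<or> U b) \<and> (V a \<or> V b)" "(U b \<or> U c) \<and> (V b \<or> V c)" "(U c \<or> U a) \<and> (V c \<or> V a)"
    "(U a' \<or> U b') \<and> (V a' \<or> V b')" "(U b' \<or> U c') \<and> (V b' \<or> V c')" "(U c' \<or> U a') \<and> (V c' \<or> V a')"
    by (rule W; use d T T' in auto)+
  \<comment> \<open>The four versions arise from exchanging the two outside edges and the roles of
    the two triangles.\<close>
  have minor: "\<not> (U x \<and> V w \<and> (adj x u \<or> adj x v) \<and> (adj x w \<or> V x))"
    "\<not> (V x \<and> U w \<and> (adj x u \<or> adj x v) \<and> (adj x w \<or> U x))"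
    "\<not> (U w \<and> V x \<and> (adj z w \<or> adj y w) \<and> (adj x w \<or> V w))"
    "\<not> (V w \<and> U x \<and> (adj z w \<or> adj y w) \<and> (adj x w \<or> U w))"
    if d: "distinct [x, y, z, u, v, w, g1, g2, h1, h2]"
      and xyz: "{x, y} \<in> R" "{y, z} \<in> R" and uvw: "{u, v} \<in> R" "{v, w} \<in> R" for x y z u v w
  proof -
    have rev: "{y, x} \<in> R" "{z, y} \<in> R" "{v, u} \<in> R" "{w, v} \<in> R"
      using xyz uvw by (simp_all add: insert_commute)
    have sym: "adj w x = adj x w" "adj w y = adj y w" "adj w z = adj z w"
      by (rule adj_sym)+
    show "\<not> (U x \<and> V w \<and> (adj x u \<or> adj x v) \<and> (adj x w \<or> V x))"
      using K5 [OF _ xyz uvw e] d unfolding U_def V_def by simp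
    show "\<not> (V x \<and> U w \<and> (adj x u \<or> adj x v) \<and> (adj x w \<or> U x))"
      using K5 [OF _ xyz uvw e(2,1)] d unfolding U_def V_def by auto
    show "\<not> (U w \<and> V x \<and> (adj z w \<or> adj y w) \<and> (adj x w \<or> V w))"
      using K5 [OF _ rev(4,3,2,1) e] d unfolding U_def V_def sym by auto
    show "\<not> (V w \<and> U x \<and> (adj z w \<or> adj y w) \<and> (adj x w \<or> U w))"
      using K5 [OF _ rev(4,3,2,1) e(2,1)] d unfolding U_def V_def sym by auto
  qed
  note minor = minor [OF _ T(1,2) T'(1,2)] minor [OF _ T(1,2) T'(2,3)] minor [OF _ T(1,2) T'(3,1)]
    minor [OF _ T(2,3) T'(1,2)] minor [OF _ T(2,3) T'(2,3)] minor [OF _ T(2,3) T'(3,1)]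
    minor [OF _ T(3,1) T'(1,2)] minor [OF _ T(3,1) T'(2,3)] minor [OF _ T(3,1) T'(3,1)]
  have "distinct [a, b, c, a', b', c', g1, g2, h1, h2]" "distinct [a, b, c, b', c', a', g1, g2, h1, h2]"
    "distinct [a, b, c, c', a', b', g1, g2, h1, h2]" "distinct [b, c, a, a', b', c', g1, g2, h1, h2]"
    "distinct [b, c, a, b', c', a', g1, g2, h1, h2]" "distinct [b, c, a, c', a', b', g1, g2, h1, h2]"
    "distinct [c, a, b, a', b', c', g1, g2, h1, h2]" "distinct [c, a, b, b', c', a', g1, g2, h1, h2]"
    "distinct [c, a, b, c', a', b', g1, g2, h1, h2]"
    using d by auto
  note minor = minor(1-4) [OF this(1)] minor(5-8) [OF this(2)] minor(9-12) [OF this(3)]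
    minor(13-16) [OF this(4)] minor(17-20) [OF this(5)] minor(21-24) [OF this(6)]
    minor(25-28) [OF this(7)] minor(29-32) [OF this(8)] minor(33-36) [OF this(9)]
  show False using cross edge minor by sat
qed

section \<open>K3,3 minors and the cycle of length nine\<close>

lemma linked_segment:
  assumes "\<And>k. Suc k < n \<Longrightarrow> adj (c k) (c (Suc k))" "c ` {..<n} \<subseteq> verts G" "i < j" "j \<le> n"
  shows "linked G (c ` {i..<j})"
  using assms(3,4)
proof (induction j)
  case (Suc j)
  show ?case
  proof (cases "i = j")
    case True
    then show ?thesis using assms(2) Suc.prems by (auto intro!: linked_singleton)
  next
    case False
    then have "linked G (c ` {i..<j})" "linked G {c j}"
      using Suc assms(2) by (auto intro!: linked_singleton)
    moreover have "adj (c (j - 1)) (c j)" "j - 1 \<in> {i..<j}"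
      using assms(1) [of "j - 1"] False Suc.prems by auto
    then have "touches G (c ` {i..<j}) {c j}" unfolding touches_adj by blast
    ultimately have "linked G (c ` {i..<j} \<union> {c j})" by (rule linked_Un)
    moreover have "c ` {i..<j} \<union> {c j} = c ` {i..<Suc j}"
      using False Suc.prems by (auto simp: atLeastLessThanSuc)
    ultimately show ?thesis by simp
  qed
qed simp

text \<open>The cycle is cut into six segments starting at \<open>0, s1, \<dots>, s5\<close>; together with the three chords
  they form a \<open>K\<^sub>3\<^sub>3\<close> minor.\<close>

lemma no_three_crossing_chords:
  fixes c :: "nat \<Rightarrow> 'a"
  assumes inj: "inj_on c {..<n}" and step: "\<And>k. Suc k < n \<Longrightarrow> adj (c k) (c (Suc k))"
    and close: "adj (c (n - 1)) (c 0)"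
    and s: "s0 < s1" "s1 < s2" "s2 < s3" "s3 < s4" "s4 < s5" "s5 < n"
    and chords: "adj (c s0) (c s3)" "adj (c s1) (c s4)" "adj (c s2) (c s5)"
  shows False
proof -
  have vc: "c ` {..<n} \<subseteq> verts G"
  proof (clarify)
    fix k assume "k < n"
    show "c k \<in> verts G"
    proof (cases "Suc k < n")
      case True
      then show ?thesis using adj_verts [OF step] by blast
    next
      case False
      then have "k = n - 1" using \<open>k < n\<close> by simp
      then show ?thesis using adj_verts [OF close] by blast
    qed
  qed
  \<comment> \<open>The first segment starts at 0, not at \<open>s0\<close>, so that the segments
    exhaust the cycle and the closing edge joins the last segment to the first.\<close>
  define t where "t k = [0, s1, s2, s3, s4, s5, n] ! k" for k
  have t [simp]: "t 0 = 0" "t 1 = s1" "t (Suc 0) = s1" "t (Suc (Suc 0)) = s2" "t 2 = s2" "t 3 = s3" "t 4 = s4" "t 5 = s5" "t 6 = n"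
    by (simp_all add: t_def)
  define B where "B k = c ` {t k..<t (Suc k)}" for k
  have lt6: "a < 6 \<longleftrightarrow> a = 0 \<or> a = 1 \<or> a = 2 \<or> a = 3 \<or> a = 4 \<or> a = 5" for a :: nat by auto
  have mono: "t a < t (Suc a) \<and> t (Suc a) \<le> n" if "a < 6" for a
    using that s unfolding lt6 by (elim disjE) simp_all
  have mono': "t a \<le> t b" if "a \<le> b" "b \<le> 6" for a b
    using that by (induction b rule: dec_induct) (use mono in \<open>auto intro: order_trans [OF _ less_imp_le]\<close>)
  have mem: "c k \<in> B a" if "t a \<le> k" "k < t (Suc a)" for k a
    using that unfolding B_def by auto
  have next_seg: "touches G (B a) (B (Suc a))" if "a < 5" for a
  proof -
    have "t (Suc a) - 1 < t (Suc a)" "t a \<le> t (Suc a) - 1" using mono [of a] that by auto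
    then have "c (t (Suc a) - 1) \<in> B a" by (intro mem)
    moreover have "c (t (Suc a)) \<in> B (Suc a)" using mono [of "Suc a"] that by (intro mem) auto
    moreover have "adj (c (t (Suc a) - 1)) (c (t (Suc a)))"
      using step [of "t (Suc a) - 1"] mono [of a] mono [of "Suc a"] that by simp
    ultimately show ?thesis unfolding touches_adj by blast
  qed
  have "c s0 \<in> B 0" "c s1 \<in> B 1" "c s2 \<in> B 2" "c s3 \<in> B 3" "c s4 \<in> B 4" "c s5 \<in> B 5"
    "c 0 \<in> B 0" "c (n - 1) \<in> B 5"
    using s by (simp_all add: mem)
  then have far: "touches G (B 0) (B 3)" "touches G (B 1) (B 4)" "touches G (B 2) (B 5)"
    "touches G (B 0) (B 5)"
    unfolding touches_adj using chords close adj_sym by blast+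
  show False
  proof (rule planar_no_K33_minor [OF planar, of B])
    show "linked G (B a)" if "a < 6" for a
      unfolding B_def using mono [OF that] by (intro linked_segment [OF step vc]) auto
    show "B a \<inter> B b = {}" if "a < b" "b < 6" for a b
    proof -
      have "{t a..<t (Suc a)} \<inter> {t b..<t (Suc b)} = {}" using mono' [of "Suc a" b] that by auto
      moreover have "{t a..<t (Suc a)} \<subseteq> {..<n}" "{t b..<t (Suc b)} \<subseteq> {..<n}"
        using mono [of a] mono [of b] that by auto
      ultimately show ?thesis
        unfolding B_def using inj_on_image_Int [OF inj] by (metis image_empty)
    qed
    show "touches G (B a) (B b)" if ab: "a < b" "b < 6" "odd (a + b)" for a b
    proof -
      have "a < 6" using ab by simp
      then have "b = Suc a \<or> (a, b) \<in> {(0, 3), (1, 4), (2, 5), (0, 5)}"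
        using ab unfolding lt6 by (elim disjE) simp_all
      then show ?thesis using next_seg [of a] far ab by auto
    qed
  qed
qed

text \<open>Opposite edges of the cycle need a chord spanning three or four steps (\<open>A0\<close>
  to \<open>A8\<close>). A vertex cannot have such chords to both of the far edges on its two sides
  (\<open>W0\<close> to \<open>W8\<close>), as it already touches the cycle edge two steps long on
  either side. These conditions leave configurations that only crossing chords exclude.\<close>

lemma no_C9:
  assumes d: "distinct [v0, v1, v2, v3, v4, v5, v6, v7, v8]"
    and V: "{v0, v1} \<in> R" "{v1, v2} \<in> R" "{v2, v3} \<in> R" "{v3, v4} \<in> R" "{v4, v5} \<in> R"
      "{v5, v6} \<in> R" "{v6, v7} \<in> R" "{v7, v8} \<in> R" "{v8, v0} \<in> R"
  shows False
proof -
  have sides: "\<not> ((adj x r \<or> adj x s) \<and> (adj x t \<or> adj x u))"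
    if "distinct [x, p, q, r, s, t, u, v, w]" "{x, p} \<in> R" "{p, q} \<in> R" "{r, s} \<in> R" "{t, u} \<in> R"
      "{v, w} \<in> R" "{w, x} \<in> R" for x p q r s t u v w
  proof
    assume "(adj x r \<or> adj x s) \<and> (adj x t \<or> adj x u)"
    moreover have "adj x p" "adj w x" using R_adj that by blast+
    moreover from this have "adj x w" using adj_sym by blast
    ultimately have "touches G {x} {p, q}" "touches G {x} {r, s}" "touches G {x} {t, u}"
      "touches G {x} {v, w}" "x \<in> verts G"
      using adj_verts [of x p] by (simp_all add: touches_adj)
    then show False
      using no_vertex_four_edges [OF _ that(3-6), of x] that(1) by auto
  qed
  define c where "c i = [v0, v1, v2, v3, v4, v5, v6, v7, v8] ! i" for i
  have c [simp]: "c 0 = v0" "c 1 = v1" "c (Suc 0) = v1" "c 2 = v2" "c 3 = v3" "c 4 = v4" "c 5 = v5"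
    "c 6 = v6" "c 7 = v7" "c 8 = v8"
    by (simp_all add: c_def)
  have crossing: "\<not> (adj (c s0) (c s3) \<and> adj (c s1) (c s4) \<and> adj (c s2) (c s5))"
    if "s0 < s1" "s1 < s2" "s2 < s3" "s3 < s4" "s4 < s5" "s5 < 9" for s0 s1 s2 s3 s4 s5
  proof -
    have "inj_on c {..<9}"
      using d inj_on_nth [of "[v0, v1, v2, v3, v4, v5, v6, v7, v8]" "{..<9}"] unfolding c_def by simp
    moreover have "adj (c k) (c (Suc k))" if "Suc k < 9" for k
    proof -
      have "k = 0 \<or> k = 1 \<or> k = 2 \<or> k = 3 \<or> k = 4 \<or> k = 5 \<or> k = 6 \<or> k = 7" using that by auto
      then show ?thesis using V R_adj by (auto simp: c_def)
    qed
    moreover have "adj (c (9 - 1)) (c 0)" using V(9) R_adj by simp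
    ultimately show ?thesis using no_three_crossing_chords that by blast
  qed
  \<comment> \<open>Each triple consists of pairwise crossing chords spanning four steps the shorter
    way round, with six different ends; these eight triples suffice for the final propositional
    check.\<close>
  have X: "\<not> (adj v0 v4 \<and> adj v1 v5 \<and> adj v3 v8)"
    "\<not> (adj v0 v4 \<and> adj v1 v6 \<and> adj v3 v7)"
    "\<not> (adj v0 v5 \<and> adj v2 v6 \<and> adj v3 v8)"
    "\<not> (adj v0 v5 \<and> adj v3 v7 \<and> adj v4 v8)"
    "\<not> (adj v1 v5 \<and> adj v2 v6 \<and> adj v3 v7)"
    "\<not> (adj v1 v6 \<and> adj v2 v7 \<and> adj v3 v8)"
    "\<not> (adj v1 v5 \<and> adj v2 v7 \<and> adj v4 v8)"
    "\<not> (adj v1 v6 \<and> adj v2 v7 \<and> adj v4 v8)"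
    using crossing [of 0 1 3 4 5 8]
      crossing [of 0 1 3 4 6 7]
      crossing [of 0 2 3 5 6 8]
      crossing [of 0 3 4 5 7 8]
      crossing [of 1 2 3 5 6 7]
      crossing [of 1 2 3 6 7 8]
      crossing [of 1 2 4 5 7 8]
      crossing [of 1 2 4 6 7 8] by simp_all
  have W0: "\<not> ((adj v0 v3 \<or> adj v0 v4) \<and> (adj v0 v5 \<or> adj v0 v6))"
    by (rule sides [OF _ V(1) V(2) V(4) V(6) V(8) V(9)]) (use d in auto)
  have W1: "\<not> ((adj v1 v4 \<or> adj v1 v5) \<and> (adj v1 v6 \<or> adj v1 v7))"
    by (rule sides [OF _ V(2) V(3) V(5) V(7) V(9) V(1)]) (use d in auto)
  have W2: "\<not> ((adj v2 v5 \<or> adj v2 v6) \<and> (adj v2 v7 \<or> adj v2 v8))"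
    by (rule sides [OF _ V(3) V(4) V(6) V(8) V(1) V(2)]) (use d in auto)
  have W3: "\<not> ((adj v3 v6 \<or> adj v3 v7) \<and> (adj v3 v8 \<or> adj v3 v0))"
    by (rule sides [OF _ V(4) V(5) V(7) V(9) V(2) V(3)]) (use d in auto)
  have W4: "\<not> ((adj v4 v7 \<or> adj v4 v8) \<and> (adj v4 v0 \<or> adj v4 v1))"
    by (rule sides [OF _ V(5) V(6) V(8) V(1) V(3) V(4)]) (use d in auto)
  have W5: "\<not> ((adj v5 v8 \<or> adj v5 v0) \<and> (adj v5 v1 \<or> adj v5 v2))"
    by (rule sides [OF _ V(6) V(7) V(9) V(2) V(4) V(5)]) (use d in auto)
  have W6: "\<not> ((adj v6 v0 \<or> adj v6 v1) \<and> (adj v6 v2 \<or> adj v6 v3))"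
    by (rule sides [OF _ V(7) V(8) V(1) V(3) V(5) V(6)]) (use d in auto)
  have W7: "\<not> ((adj v7 v1 \<or> adj v7 v2) \<and> (adj v7 v3 \<or> adj v7 v4))"
    by (rule sides [OF _ V(8) V(9) V(2) V(4) V(6) V(7)]) (use d in auto)
  have W8: "\<not> ((adj v8 v2 \<or> adj v8 v3) \<and> (adj v8 v4 \<or> adj v8 v5))"
    by (rule sides [OF _ V(9) V(1) V(3) V(5) V(7) V(8)]) (use d in auto)
  have A0: "adj v0 v4 \<or> adj v0 v5 \<or> adj v1 v4 \<or> adj v1 v5"
    by (rule R_touches_pairs [OF V(1) V(5)]) (use d in auto)
  have A1: "adj v1 v5 \<or> adj v1 v6 \<or> adj v2 v5 \<or> adj v2 v6"
    by (rule R_touches_pairs [OF V(2) V(6)]) (use d in auto)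
  have A2: "adj v2 v6 \<or> adj v2 v7 \<or> adj v3 v6 \<or> adj v3 v7"
    by (rule R_touches_pairs [OF V(3) V(7)]) (use d in auto)
  have A3: "adj v3 v7 \<or> adj v3 v8 \<or> adj v4 v7 \<or> adj v4 v8"
    by (rule R_touches_pairs [OF V(4) V(8)]) (use d in auto)
  have A4: "adj v4 v8 \<or> adj v4 v0 \<or> adj v5 v8 \<or> adj v5 v0"
    by (rule R_touches_pairs [OF V(5) V(9)]) (use d in auto)
  have A5: "adj v5 v0 \<or> adj v5 v1 \<or> adj v6 v0 \<or> adj v6 v1"
    by (rule R_touches_pairs [OF V(6) V(1)]) (use d in auto)
  have A6: "adj v6 v1 \<or> adj v6 v2 \<or> adj v7 v1 \<or> adj v7 v2"
    by (rule R_touches_pairs [OF V(7) V(2)]) (use d in auto)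
  have A7: "adj v7 v2 \<or> adj v7 v3 \<or> adj v8 v2 \<or> adj v8 v3"
    by (rule R_touches_pairs [OF V(8) V(3)]) (use d in auto)
  have A8: "adj v8 v3 \<or> adj v8 v4 \<or> adj v0 v3 \<or> adj v0 v4"
    by (rule R_touches_pairs [OF V(9) V(4)]) (use d in auto)
  have sym: "adj v3 v0 = adj v0 v3" "adj v4 v0 = adj v0 v4" "adj v5 v0 = adj v0 v5"
    "adj v6 v0 = adj v0 v6" "adj v4 v1 = adj v1 v4" "adj v5 v1 = adj v1 v5"
    "adj v6 v1 = adj v1 v6" "adj v7 v1 = adj v1 v7" "adj v5 v2 = adj v2 v5"
    "adj v6 v2 = adj v2 v6" "adj v7 v2 = adj v2 v7" "adj v8 v2 = adj v2 v8"
    "adj v6 v3 = adj v3 v6" "adj v7 v3 = adj v3 v7" "adj v8 v3 = adj v3 v8"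
    "adj v7 v4 = adj v4 v7" "adj v8 v4 = adj v4 v8" "adj v8 v5 = adj v5 v8"
    by (rule adj_sym)+
  show False
    using X W0 W1 W2 W3 W4 W5 W6 W7 W8 A0 A1 A2 A3 A4 A5 A6 A7 A8 sym by sat
qed

section \<open>Bounding packings and the case of equality\<close>

lemma R_card: "\<forall>e\<in>R. card e = 2"
  using simple neighbouring unfolding simple_graph_def neighbouring_def by blast

lemma finite_R: "finite R"
proof (rule finite_subset)
  show "R \<subseteq> Pow (verts G)"
    using simple neighbouring unfolding simple_graph_def neighbouring_def by blast
  show "finite (Pow (verts G))" using simple unfolding simple_graph_def by simp
qed

lemma R_nonempty: "{} \<notin> R"
  using R_card by auto

lemma packing_bound:
  "packing R P Cs \<Longrightarrow> card P + (\<Sum>C\<leftarrow>Cs. length C div 2) \<le> 4"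
proof (induction Cs arbitrary: P)
  case Nil
  then have P: "P \<subseteq> R" "disjoint P" unfolding packing_def by blast+
  show ?case
  proof (rule ccontr)
    assume "\<not> ?thesis"
    then have "5 \<le> card P" by simp
    then obtain Q where Q: "Q \<subseteq> P" "card Q = 5" by (meson obtain_subset_with_card_n)
    have "disjoint Q" using pairwise_subset [OF P(2) Q(1)] .
    then show False using no_five_disjoint_edges Q P(1) by (meson subset_trans)
  qed
next
  case (Cons C Cs)
  obtain P' where P': "packing R P' Cs \<and> card P' = card P + length C div 2"
    using packing_drop_cycle [OF Cons.prems R_nonempty] ..
  then show ?case using Cons.IH [of P'] by simp
qed

lemma odd_cycle_edges:
  "odd_cycle R [a, b, c] \<Longrightarrow> {a, b} \<in> R \<and> {b, c} \<in> R \<and> {c, a} \<in> R"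
  "odd_cycle R [a, b, c, d, e] \<Longrightarrow>
    {a, b} \<in> R \<and> {b, c} \<in> R \<and> {c, d} \<in> R \<and> {d, e} \<in> R \<and> {e, a} \<in> R"
  "odd_cycle R [a, b, c, d, e, f, g] \<Longrightarrow>
    {a, b} \<in> R \<and> {b, c} \<in> R \<and> {c, d} \<in> R \<and> {d, e} \<in> R \<and> {e, f} \<in> R \<and> {f, g} \<in> R \<and> {g, a} \<in> R"
  "odd_cycle R [a, b, c, d, e, f, g, h, i] \<Longrightarrow>
    {a, b} \<in> R \<and> {b, c} \<in> R \<and> {c, d} \<in> R \<and> {d, e} \<in> R \<and> {e, f} \<in> R \<and> {f, g} \<in> R \<and>
    {g, h} \<in> R \<and> {h, i} \<in> R \<and> {i, a} \<in> R"
  unfolding odd_cycle_def by (simp_all add: All_less_Suc2)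

lemma list_of_length:
  "length C = 3 \<Longrightarrow> \<exists>a b c. C = [a, b, c]"
  "length C = 5 \<Longrightarrow> \<exists>a b c d e. C = [a, b, c, d, e]"
  "length C = 7 \<Longrightarrow> \<exists>a b c d e f g. C = [a, b, c, d, e, f, g]"
  "length C = 9 \<Longrightarrow> \<exists>a b c d e f g h i. C = [a, b, c, d, e, f, g, h, i]"
  by (auto simp: numeral_eq_Suc length_Suc_conv)

lemma R_pair: "e \<in> R \<Longrightarrow> \<exists>x y. e = {x, y} \<and> x \<noteq> y"
  using R_card by (meson card_2_iff)

lemma packing_cards:
  assumes "packing R P Cs" "C \<in> set Cs"
  shows "\<exists>k. length C = 2 * k + 1 \<and> length C div 2 = k \<and> 1 \<le> k"
proof -
  have "odd (length C)" "3 \<le> length C" using assms unfolding packing_def odd_cycle_def by auto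
  then show ?thesis by (elim oddE) auto
qed

text \<open>Lists the matching as ordered pairs and puts all vertices of the packing into one
  distinct list, the form in which the excluded configurations are stated.\<close>

lemma packing_edges_list:
  assumes "packing R P Cs"
  shows "\<exists>ps. length ps = card P \<and> (\<forall>(x, y)\<in>set ps. {x, y} \<in> R) \<and>
    distinct (concat Cs @ concat (map (\<lambda>(x, y). [x, y]) ps))"
proof -
  have ex: "\<exists>ps. length ps = card P \<and> (\<forall>(x, y)\<in>set ps. {x, y} \<in> R) \<and>
    distinct (concat (map (\<lambda>(x, y). [x, y]) ps)) \<and> set (concat (map (\<lambda>(x, y). [x, y]) ps)) = \<Union>P"
    if "finite P" "P \<subseteq> R" "disjoint P" for P
    using that
  proof (induction P rule: finite_induct)
    case empty
    show ?case by (rule exI [of _ "[]"]) simp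
  next
    case (insert e P)
    have "disjoint P" using insert.prems(2) by (rule pairwise_subset) blast
    have disj: "e \<inter> f = {}" if "f \<in> P" for f
      using disjointD [OF insert.prems(2), of e f] insert.hyps(2) that by auto
    obtain ps where ps: "length ps = card P" "\<forall>(x, y)\<in>set ps. {x, y} \<in> R"
      "distinct (concat (map (\<lambda>(x, y). [x, y]) ps))" "set (concat (map (\<lambda>(x, y). [x, y]) ps)) = \<Union>P"
      using insert.IH [OF _ \<open>disjoint P\<close>] insert.prems(1) by blast
    obtain x y where xy: "e = {x, y}" "x \<noteq> y" using R_pair insert.prems(1) by blast
    have "x \<notin> \<Union>P" "y \<notin> \<Union>P" using disj xy by auto
    then have "distinct (concat (map (\<lambda>(x, y). [x, y]) ((x, y) # ps)))"
      using ps(3,4) xy(2) by simp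
    moreover have "set (concat (map (\<lambda>(x, y). [x, y]) ((x, y) # ps))) = \<Union>(insert e P)"
      using ps(4) xy(1) by simp
    ultimately show ?case
      using ps(1,2) insert.hyps insert.prems(1) xy(1) by (intro exI [of _ "(x, y) # ps"]) simp
  qed
  have cs: "distinct (concat Cs)" "set (concat Cs) \<inter> \<Union>P = {}"
    using assms unfolding packing_def by blast+
  have "finite P" "P \<subseteq> R" "disjoint P" using assms unfolding packing_def by blast+
  from ex [OF this] obtain ps where ps: "length ps = card P" "\<forall>(x, y)\<in>set ps. {x, y} \<in> R"
      "distinct (concat (map (\<lambda>(x, y). [x, y]) ps))" "set (concat (map (\<lambda>(x, y). [x, y]) ps)) = \<Union>P"
    by blast
  then have "distinct (concat Cs @ concat (map (\<lambda>(x, y). [x, y]) ps))"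
    using cs unfolding distinct_append by blast
  then show ?thesis using ps(1,2) by blast
qed

lemma no_two_cycle_packing:
  assumes P: "packing R P [C, D]" and sum: "card P + length C div 2 + length D div 2 = 4"
    and le: "length C \<le> length D"
  shows False
proof -
  obtain k l where k: "length C = 2 * k + 1" "length C div 2 = k" "1 \<le> k"
    and l: "length D = 2 * l + 1" "length D div 2 = l" "1 \<le> l"
    using packing_cards [OF P, of C] packing_cards [OF P, of D] by auto
  obtain ps where ps: "length ps = card P" "\<forall>(x, y)\<in>set ps. {x, y} \<in> R"
    "distinct (C @ D @ concat (map (\<lambda>(x, y). [x, y]) ps))"
    using packing_edges_list [OF P] by auto
  have cyc: "odd_cycle R C" "odd_cycle R D" using P unfolding packing_def by auto
  have "k + l + card P = 4" "k \<le> l" using sum k l le by auto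
  \<comment> \<open>The solutions of \<open>k + l + card P = 4\<close> with \<open>1 \<le> k\<close>
    and \<open>k \<le> l\<close>: 2K3 + 2K2, K3 + C5 + K2, K3 + C7 and 2C5.\<close>
  then consider "k = 1" "l = 1" "length ps = 2" | "k = 1" "l = 2" "length ps = 1"
    | "k = 1" "l = 3" | "k = 2" "l = 2"
    using k(3) l(3) ps(1) by linarith
  then show False
  proof cases
    case 1
    then obtain a b c a' b' c' where C: "C = [a, b, c]" "D = [a', b', c']"
      using list_of_length(1) [of C] list_of_length(1) [of D] k(1) l(1) by auto
    obtain g1 g2 h1 h2 where p: "ps = [(g1, g2), (h1, h2)]"
      using 1(3) by (auto simp: numeral_eq_Suc length_Suc_conv)
    have "distinct [a, b, c, a', b', c', g1, g2, h1, h2]" "{g1, g2} \<in> R" "{h1, h2} \<in> R"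
      using ps(2,3) unfolding C p by simp_all
    then show False
      using no_2K3_2K2 odd_cycle_edges(1) cyc unfolding C by blast
  next
    case 2
    then obtain a b c v0 v1 v2 v3 v4 where C: "C = [a, b, c]" "D = [v0, v1, v2, v3, v4]"
      using list_of_length(1) [of C] list_of_length(2) [of D] k(1) l(1) by auto
    obtain g h where p: "ps = [(g, h)]"
      using 2(3) by (auto simp: numeral_eq_Suc length_Suc_conv)
    have "distinct [a, b, c, g, h, v0, v1, v2, v3, v4]" "{g, h} \<in> R"
      using ps(2,3) unfolding C p by auto
    then show False
      using no_K3_C5_K2 odd_cycle_edges(1,2) cyc unfolding C by blast
  next
    case 3
    then obtain a b c v0 v1 v2 v3 v4 v5 v6 where C: "C = [a, b, c]" "D = [v0, v1, v2, v3, v4, v5, v6]"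
      using list_of_length(1) [of C] list_of_length(3) [of D] k(1) l(1) by auto
    have "distinct [a, b, c, v0, v1, v2, v3, v4, v5, v6]"
      using ps(3) unfolding C by simp
    then show False
      using no_K3_C7 odd_cycle_edges(1,3) cyc unfolding C by blast
  next
    case 4
    then obtain u0 u1 u2 u3 u4 v0 v1 v2 v3 v4 where C: "C = [u0, u1, u2, u3, u4]" "D = [v0, v1, v2, v3, v4]"
      using list_of_length(2) [of C] list_of_length(2) [of D] k(1) l(1) by auto
    have "distinct [u0, u1, u2, u3, u4, v0, v1, v2, v3, v4]"
      using ps(3) unfolding C by simp
    then show False
      using no_C5_C5 odd_cycle_edges(2) cyc unfolding C by blast
  qed
qed

text \<open>Cycles are traded for disjoint edges until two are left; the sum does not
  change.\<close>

lemma no_full_packing: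
  "packing R P Cs \<Longrightarrow> 2 \<le> length Cs \<Longrightarrow> card P + (\<Sum>C\<leftarrow>Cs. length C div 2) \<noteq> 4"
proof (induction Cs arbitrary: P)
  case (Cons C Cs)
  show ?case
  proof (cases "length Cs = 1")
    case True
    then obtain D where Cs: "Cs = [D]" by (auto simp: length_Suc_conv)
    have P: "packing R P [C, D]" using Cons.prems(1) Cs by simp
    then have "packing R P [D, C]" unfolding packing_def by auto
    with P show ?thesis
      using no_two_cycle_packing [of P C D] no_two_cycle_packing [of P D C] Cs
        linear [of "length C" "length D"] by (auto simp: ac_simps)
  next
    case False
    obtain P' where P': "packing R P' Cs \<and> card P' = card P + length C div 2"
      using packing_drop_cycle [OF Cons.prems(1) R_nonempty] ..
    then show ?thesis using Cons.IH [of P'] Cons.prems(2) False by simp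
  qed
qed simp

lemma length_concat_packing:
  assumes "packing R P Cs"
  shows "length (concat Cs) = 2 * (\<Sum>C\<leftarrow>Cs. length C div 2) + length Cs"
    "length Cs \<le> (\<Sum>C\<leftarrow>Cs. length C div 2)"
proof -
  have "length (concat Cs) = 2 * (\<Sum>C\<leftarrow>Cs. length C div 2) + length Cs \<and>
      length Cs \<le> (\<Sum>C\<leftarrow>Cs. length C div 2)"
    if "\<forall>C\<in>set Cs. odd (length C) \<and> 3 \<le> length C"
    using that
  proof (induction Cs)
    case (Cons C Cs)
    then have "odd (length C)" "3 \<le> length C" by auto
    then have "length C = 2 * (length C div 2) + 1" "1 \<le> length C div 2" by (auto elim!: oddE)
    then show ?case using Cons by simp
  qed simp
  moreover have "\<forall>C\<in>set Cs. odd (length C) \<and> 3 \<le> length C"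
    using assms unfolding packing_def odd_cycle_def by simp
  ultimately show "length (concat Cs) = 2 * (\<Sum>C\<leftarrow>Cs. length C div 2) + length Cs"
    "length Cs \<le> (\<Sum>C\<leftarrow>Cs. length C div 2)"
    by simp_all
qed

text \<open>The left side is twice the sum bounded by \<open>packing_bound\<close>, plus the number
  of cycles. With at most one cycle this is at most 8 + 1. With more, the sum is at most 3, and so
  is the number of cycles, giving 6 + 3.\<close>

lemma packing_le_9:
  assumes "packing R P Cs"
  shows "2 * card P + length (concat Cs) \<le> 9"
proof -
  note len = length_concat_packing [OF assms] and bound = packing_bound [OF assms]
  show ?thesis
  proof (cases "2 \<le> length Cs")
    case True
    then have "card P + (\<Sum>C\<leftarrow>Cs. length C div 2) < 4"
      using no_full_packing [OF assms] bound by (simp add: le_neq_implies_less)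
    then show ?thesis using len by linarith
  next
    case False
    then show ?thesis using len bound by linarith
  qed
qed

lemma packing_9:
  assumes P: "packing R P Cs" and 9: "9 \<le> 2 * card P + length (concat Cs)"
  shows "contains_subgraph (edge_induced R) (copies 3 (complete_graph 3)) \<or>
    contains_subgraph (edge_induced R) (disjoint_union (complete_graph 3) (copies 3 (complete_graph 2))) \<or>
    contains_subgraph (edge_induced R) (disjoint_union (cycle_graph 7) (complete_graph 2))"
proof -
  let ?K = "\<Sum>C\<leftarrow>Cs. length C div 2"
  note len = length_concat_packing [OF P] and bound = packing_bound [OF P]
  obtain ps where ps: "length ps = card P" "\<forall>(x, y)\<in>set ps. {x, y} \<in> R"
    "distinct (concat Cs @ concat (map (\<lambda>(x, y). [x, y]) ps))"
    using packing_edges_list [OF P] by blast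
  have cyc: "odd_cycle R C" if "C \<in> set Cs" for C using P that unfolding packing_def by blast
  show ?thesis
  proof (cases "2 \<le> length Cs")
    case True
    then have "card P + ?K < 4"
      using no_full_packing [OF P] bound by (simp add: le_neq_implies_less)
    \<comment> \<open>Equality in 6 + 3 leaves one disjoint edge per cycle, so every cycle is a
      triangle and no single edge remains.\<close>
    then have "length Cs = 3" "?K = 3" using 9 len by linarith+
    then obtain C D E where Cs: "Cs = [C, D, E]" using list_of_length(1) by blast
    have "length C = 3 \<and> length D = 3 \<and> length E = 3"
    proof -
      obtain k l m where "length C = 2 * k + 1" "length C div 2 = k" "1 \<le> k"
        "length D = 2 * l + 1" "length D div 2 = l" "1 \<le> l"
        "length E = 2 * m + 1" "length E div 2 = m" "1 \<le> m"
        using packing_cards [OF P, of C] packing_cards [OF P, of D] packing_cards [OF P, of E] Cs by auto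
      then show ?thesis using \<open>?K = 3\<close> Cs by simp
    qed
    then obtain a0 a1 a2 b0 b1 b2 c0 c1 c2
      where C: "C = [a0, a1, a2]" "D = [b0, b1, b2]" "E = [c0, c1, c2]"
      using list_of_length(1) by metis
    have d: "distinct [a0, a1, a2, b0, b1, b2, c0, c1, c2]" using ps(3) unfolding Cs C by simp
    have "odd_cycle R [a0, a1, a2]" "odd_cycle R [b0, b1, b2]" "odd_cycle R [c0, c1, c2]"
      using cyc unfolding Cs C by simp_all
    from this [THEN odd_cycle_edges(1)] show ?thesis using contains_3K3 [OF d] by simp
  next
    case False
    then have "length Cs = 1" "card P + ?K = 4" using 9 len bound by linarith+
    then obtain C where Cs: "Cs = [C]" by (auto simp: length_Suc_conv)
    obtain k where k: "length C = 2 * k + 1" "length C div 2 = k" "1 \<le> k"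
      using packing_cards [OF P, of C] Cs by auto
    have "length ps + k = 4" using \<open>card P + ?K = 4\<close> Cs k ps(1) by simp
    then consider "k = 1" "length ps = 3" | "k = 2" "length ps = 2" | "k = 3" "length ps = 1" | "k = 4"
      using k(3) by linarith
    then show ?thesis
    proof cases
      case 1
      obtain a0 a1 a2 where C: "C = [a0, a1, a2]" using list_of_length(1) [of C] k 1 by auto
      obtain x0 y0 x1 y1 x2 y2 where p: "ps = [(x0, y0), (x1, y1), (x2, y2)]"
        using 1(2) by (auto simp: numeral_eq_Suc length_Suc_conv)
      have pk: "distinct [a0, a1, a2, x0, y0, x1, y1, x2, y2]" "{x0, y0} \<in> R" "{x1, y1} \<in> R" "{x2, y2} \<in> R"
        using ps(2,3) unfolding Cs C p by simp_all
      have "odd_cycle R [a0, a1, a2]" using cyc unfolding Cs C by simp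
      from odd_cycle_edges(1) [OF this] show ?thesis using contains_K3_3K2 [OF pk(1)] pk by simp
    next
      case 2
      obtain v0 v1 v2 v3 v4 where C: "C = [v0, v1, v2, v3, v4]" using list_of_length(2) [of C] k 2 by auto
      obtain g h g' h' where p: "ps = [(g, h), (g', h')]"
        using 2(2) by (auto simp: numeral_eq_Suc length_Suc_conv)
      have pk: "distinct [g, h, g', h', v0, v1, v2, v3, v4]" "{g, h} \<in> R" "{g', h'} \<in> R"
        using ps(2,3) unfolding Cs C p by auto
      have "odd_cycle R [v0, v1, v2, v3, v4]" using cyc unfolding Cs C by simp
      from odd_cycle_edges(2) [OF this] show ?thesis using no_C5_2K2 [OF pk] by simp
    next
      case 3
      obtain v0 v1 v2 v3 v4 v5 v6 where C: "C = [v0, v1, v2, v3, v4, v5, v6]"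
        using list_of_length(3) [of C] k 3 by auto
      obtain x y where p: "ps = [(x, y)]"
        using 3(2) by (auto simp: numeral_eq_Suc length_Suc_conv)
      have pk: "distinct [v0, v1, v2, v3, v4, v5, v6, x, y]" "{x, y} \<in> R"
        using ps(2,3) unfolding Cs C p by simp_all
      have "odd_cycle R [v0, v1, v2, v3, v4, v5, v6]" using cyc unfolding Cs C by simp
      from odd_cycle_edges(3) [OF this] show ?thesis using contains_C7_K2 [OF pk(1)] pk(2) by simp
    next
      case 4
      obtain v0 v1 v2 v3 v4 v5 v6 v7 v8 where C: "C = [v0, v1, v2, v3, v4, v5, v6, v7, v8]"
        using list_of_length(4) [of C] k 4 by auto
      have d: "distinct [v0, v1, v2, v3, v4, v5, v6, v7, v8]" using ps(3) unfolding Cs C by simp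
      have "odd_cycle R [v0, v1, v2, v3, v4, v5, v6, v7, v8]" using cyc unfolding Cs C by simp
      from odd_cycle_edges(4) [OF this] show ?thesis using no_C9 [OF d] by simp
    qed
  qed
qed

end

theorem theorem1p4:
  fixes G :: "'a graph" and R :: "'a set set"
  assumes "simple_graph G" and "planar G"
    and "R \<subseteq> edges G" and "neighbouring G R"
  shows "frac_matching_number (edge_induced R) = 9 / 2 \<longleftrightarrow>
      contains_subgraph (edge_induced R) (copies 3 (complete_graph 3)) \<or>
      contains_subgraph (edge_induced R)
        (disjoint_union (complete_graph 3) (copies 3 (complete_graph 2))) \<or>
      contains_subgraph (edge_induced R)
        (disjoint_union (cycle_graph 7) (complete_graph 2))"
    (is "?mu = _ \<longleftrightarrow> ?contains")
proof -
  interpret planar_neighbouring G R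
    using assms by unfold_locales
  obtain M where M: "arc_matching R M" "finite M" "?mu \<le> card M / 2"
    using frac_matching_number_le_arc_matching [OF finite_R R_card] by blast
  obtain P Cs where P: "packing R P Cs" "card M \<le> 2 * card P + length (concat Cs)"
    using arc_matching_packing [OF M(2,1) R_card] by metis
  show ?thesis
  proof
    assume "?mu = 9 / 2"
    then have "9 \<le> card M" using M(3) by simp
    then show ?contains using packing_9 [OF P(1)] P(2) by simp
  next
    assume ?contains
    then have "\<exists>N. arc_matching R N \<and> card N = 9"
      by (elim disjE) (erule arc_matching_3K3 arc_matching_K3_3K2 arc_matching_C7_K2)+
    then obtain N where N: "arc_matching R N" "card N = 9" by blast
    have "9 / 2 \<le> ?mu"
      using arc_matching_le_frac_matching_number [OF finite_R R_card N(1)] N(2) by simp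
    \<comment> \<open>The upper bound 9/2 holds for every neighbouring set of a planar graph; the
      subgraph is needed only for the lower bound.\<close>
    moreover have "card M \<le> 9" using P packing_le_9 [OF P(1)] by simp
    then have "?mu \<le> 9 / 2" using M(3) by simp
    ultimately show "?mu = 9 / 2" by simp
  qed
qed
end
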